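(* Let $b>0$, let $q:[-b,b]\to\mathbb{C}$ be continuous, and suppose there is a solution $f\in C^2[-b,b]$ of $f''-qf=0$ on $[-b,b]$ with $f(x)\ne 0$ for all $x\in[-b,b]$ and $f(0)=1$. Let $\mathbf{R}$ be the square (interior) with vertices $(\pm b,0)$ and $(0,\pm b)$ in the $(x,t)$-plane, with closure $\overline{\mathbf{R}}$. Let $u\in C^2(\overline{\mathbf{R}})$ be a solution in $\mathbf{R}$ of $$\Big(\frac{\partial^2}{\partial x^2}-q(x)\Big)u(x,t)=\frac{\partial^2}{\partial t^2}u(x,t).$$ Then there exists a sequence of generalized wave polynomials $U_N=\sum_{n=0}^{N}a_nu_n$ (complex coefficients, possibly depending on $N$) uniformly convergent to $u$ in $\overline{\mathbf{R}}$.
   Context: Given $f$, define on $[-b,b]$ the functions $\widetilde X^{(0)}\equiv X^{(0)}\equiv1$ and, for $n\ge1$, $$\widetilde X^{(n)}(x)=n\int_0^x\widetilde X^{(n-1)}(s)\,(f^2(s))^{(-1)^{n-1}}ds,\qquad X^{(n)}(x)=n\int_0^xX^{(n-1)}(s)\,(f^2(s))^{(-1)^{n}}ds,$$ and set $\varphi_k=fX^{(k)}$ for $k$ odd and $\varphi_k=f\widetilde X^{(k)}$ for $k$ even. The generalized wave polynomials are $u_0(x,t)=f(x)$ and, for $m\ge1$, $$u_m(x,t)=\sum_{\text{even }k=0}^{(m+1)/2}\binom{\frac{m+1}{2}}{k}\varphi_{\frac{m+1}{2}-k}(x)\,t^k\ \ (m\text{ odd}),\qquad u_m(x,t)=\sum_{\text{odd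 }k=1}^{m/2}\binom{\frac m2}{k}\varphi_{\frac m2-k}(x)\,t^k\ \ (m\text{ even}).$$ *)

theory Defs
  imports "HOL-Analysis.Analysis"
begin

text \<open>
  \<^term>\<open>LBINT s=0..x. g s\<close> is the oriented integral, so the recursions below are also
  meaningful for negative \<open>x\<close>.  The integer power encodes the alternation between
  \<open>f\<^sup>2\<close> and \<open>1/f\<^sup>2\<close>.
\<close>

primrec X_tilde :: "(real \<Rightarrow> complex) \<Rightarrow> nat \<Rightarrow> real \<Rightarrow> complex" where
  "X_tilde f 0 = (\<lambda>x. 1)"
| "X_tilde f (Suc n) =
     (\<lambda>x. of_nat (Suc n) * (LBINT s=0..x. X_tilde f n s * ((f s)\<^sup>2) powi ((-1) ^ n)))"

primrec X_plain :: "(real \<Rightarrow> complex) \<Rightarrow> nat \<Rightarrow> real \<Rightarrow> complex" where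
  "X_plain f 0 = (\<lambda>x. 1)"
| "X_plain f (Suc n) =
     (\<lambda>x. of_nat (Suc n) * (LBINT s=0..x. X_plain f n s * ((f s)\<^sup>2) powi ((-1) ^ Suc n)))"

definition phi :: "(real \<Rightarrow> complex) \<Rightarrow> nat \<Rightarrow> real \<Rightarrow> complex" where
  "phi f k x = f x * (if odd k then X_plain f k x else X_tilde f k x)"

definition wave_poly :: "(real \<Rightarrow> complex) \<Rightarrow> nat \<Rightarrow> real \<Rightarrow> real \<Rightarrow> complex" where
  "wave_poly f m x t =
     (if m = 0 then f x
      else if odd m then
        (\<Sum>k\<in>{k\<in>{0..(m + 1) div 2}. even k}.
           of_nat (((m + 1) div 2) choose k) * phi f ((m + 1) div 2 - k) x * of_real t ^ k)
      else
        (\<Sum>k\<in>{k\<in>{1..m div 2}. odd k}.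
           of_nat ((m div 2) choose k) * phi f (m div 2 - k) x * of_real t ^ k))"

definition open_square :: "real \<Rightarrow> (real \<times> real) set" where
  "open_square b = interior (convex hull {(b, 0), (- b, 0), (0, b), (0, - b)})"

definition partial_x :: "(real \<times> real \<Rightarrow> complex) \<Rightarrow> real \<times> real \<Rightarrow> complex" where
  "partial_x u p = vector_derivative (\<lambda>s. u (s, snd p)) (at (fst p))"

definition partial_t :: "(real \<times> real \<Rightarrow> complex) \<Rightarrow> real \<times> real \<Rightarrow> complex" where
  "partial_t u p = vector_derivative (\<lambda>s. u (fst p, s)) (at (snd p))"

definition has_partials_on :: "(real \<times> real \<Rightarrow> complex) \<Rightarrow> (real \<times> real) set \<Rightarrow> bool" where
  "has_partials_on u S \<longleftrightarrow>
     (\<forall>(x, t)\<in>S. (\<lambda>s. u (s, t)) differentiable (at x) \<and> (\<lambda>s. u (x, s)) differentiable (at t))"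

definition extends_continuously :: "(real \<times> real \<Rightarrow> complex) \<Rightarrow> (real \<times> real) set \<Rightarrow> bool" where
  "extends_continuously v S \<longleftrightarrow> (\<exists>g. continuous_on (closure S) g \<and> (\<forall>p\<in>S. g p = v p))"

text \<open>
  For an open set \<open>S\<close>, the class \<open>C\<^sup>2\<close> on the closure of \<open>S\<close>: the function is continuous on the
  closure, and all its partial derivatives of order one and two exist in \<open>S\<close> and extend
  continuously to the closure.  (Continuity in \<open>S\<close> of the derivatives is part of the latter.)
\<close>

definition C2_on_closure :: "(real \<times> real \<Rightarrow> complex) \<Rightarrow> (real \<times> real) set \<Rightarrow> bool" where
  "C2_on_closure u S \<longleftrightarrow>
     continuous_on (closure S) u \<and>
     has_partials_on u S \<and> has_partials_on (partial_x u) S \<and> has_partials_on (partial_t u) S \<and>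
     (\<forall>v\<in>{partial_x u, partial_t u,
            partial_x (partial_x u), partial_t (partial_x u),
            partial_x (partial_t u), partial_t (partial_t u)}. extends_continuously v S)"

end

theory Submission
  imports Defs
begin

text \<open>
  The idea is to read the equation with \<open>x\<close> as the time variable.  The square is symmetric in
  \<open>x\<close> and \<open>t\<close>, so it is also the domain of determinacy of its vertical diagonal: a solution in the
  square is controlled, uniformly, by its Cauchy data \<open>(u(0,t), u\<^sub>x(0,t))\<close> on
  \<open>{0} \<times> [-b,b]\<close>.  On that diagonal the wave polynomials are completely explicit.  Since
  \<open>\<phi>\<^sub>0(0) = 1\<close>, \<open>\<phi>\<^sub>0'(0) = f'(0)\<close>, \<open>\<phi>\<^sub>1'(0) = 1\<close> and all other values \<open>\<phi>\<^sub>k(0)\<close>, \<open>\<phi>\<^sub>k'(0)\<close> are zero,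
  for \<open>n \<ge> 1\<close> one of \<open>u\<^sub>2\<^sub>n\<^sub>-\<^sub>1\<close>, \<open>u\<^sub>2\<^sub>n\<close> has data \<open>(t^n, f'(0) t^n)\<close> and the other has data
  \<open>(0, n t^(n-1))\<close>, while \<open>u\<^sub>0\<close> has data \<open>(1, f'(0))\<close>.
  Their span therefore contains a solution with data \<open>(P, f'(0) P + R)\<close> for every pair of
  polynomials \<open>P\<close>, \<open>R\<close> (\<open>attains_polynomial_data\<close>), and the Weierstrass theorem provides
  \<open>P\<close> and \<open>R\<close> for which these data are close to those of \<open>u\<close>.

  Stability is obtained from the Riemann invariants \<open>v = w\<^sub>x + w\<^sub>t\<close> and \<open>z = w\<^sub>x - w\<^sub>t\<close>.  For a
  solution \<open>w\<close> they satisfy \<open>(\<partial>\<^sub>x - \<partial>\<^sub>t) v = q w\<close> and \<open>(\<partial>\<^sub>x + \<partial>\<^sub>t) z = q w\<close>, while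
  \<open>w\<^sub>x = (v + z) / 2\<close>.  Each of the three unknowns is thus differentiated along lines that lead from
  any point of the square to the diagonal without leaving the square.  The mean value inequality
  along these lines, in the norm weighted by \<open>exp (- l \<bar>x\<bar>)\<close> with \<open>l\<close> large, is a contraction estimate
  and bounds \<open>w\<close> by the data (\<open>riemann_system_stability\<close>).  Because \<open>v\<close> and \<open>z\<close> contain \<open>w\<^sub>t\<close>, the
  data must be close in \<open>C\<^sup>1\<close> in the first component; for this reason \<open>P\<close> is taken as an
  antiderivative of a polynomial approximating \<open>u\<^sub>t(0,\<cdot>)\<close>.
  
  For \<open>u\<close> itself, the passage to the first-order system needs the symmetry of the mixed second
  derivatives and the chain rule along characteristics (\<open>riemann_system_classical_solution\<close>).  For the
  wave polynomials it is an identity for the sums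
  \<open>\<Sum>\<^sub>k (n choose k) \<phi>\<^sub>n\<^sub>-\<^sub>k(x) (\<plusminus>t)^k\<close> (\<open>riemann_system_binomial_mix\<close>), whose even and odd parts in \<open>t\<close>
  are the \<open>u\<^sub>m\<close>.
\<close>

section \<open>The square as a ball for the sum norm\<close>

lemma convex_hull_diamond:
  assumes "b > 0"
  shows "convex hull {(b, 0), (- b, 0), (0, b), (0, - b)} = {(x, t). \<bar>x\<bar> + \<bar>t\<bar> \<le> (b::real)}"
    (is "?H = ?D")
proof
  have "convex ?D"
  proof (rule convexI)
    fix p p' :: "real \<times> real" and c d :: real
    assume p: "p \<in> ?D" "p' \<in> ?D" and cd: "0 \<le> c" "0 \<le> d" "c + d = 1"
    have "\<bar>c * fst p + d * fst p'\<bar> + \<bar>c * snd p + d * snd p'\<bar>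
          \<le> (c * \<bar>fst p\<bar> + d * \<bar>fst p'\<bar>) + (c * \<bar>snd p\<bar> + d * \<bar>snd p'\<bar>)"
      using cd by (intro add_mono order_trans[OF abs_triangle_ineq]) (auto simp: abs_mult)
    also have "\<dots> = c * (\<bar>fst p\<bar> + \<bar>snd p\<bar>) + d * (\<bar>fst p'\<bar> + \<bar>snd p'\<bar>)"
      by (simp add: algebra_simps)
    also have "\<dots> \<le> c * b + d * b"
      using p cd by (intro add_mono mult_left_mono) auto
    also have "\<dots> = b"
      using cd by (metis distrib_right mult_1)
    finally show "c *\<^sub>R p + d *\<^sub>R p' \<in> ?D"
      by (auto simp: case_prod_beta)
  qed
  then show "?H \<subseteq> ?D"
    using assms by (intro hull_minimal) auto
next
  have H: "convex ?H" by simp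
  \<comment> \<open>Each point of the diamond lies in a triangle with apex \<open>0\<close> and two adjacent vertices.\<close>
  have zero: "(0, 0) \<in> ?H"
  proof -
    have "(1/2) *\<^sub>R (b, 0::real) + (1/2) *\<^sub>R (- b, 0) \<in> ?H"
      by (rule convexD[OF H]) (auto intro: hull_inc)
    then show ?thesis by simp
  qed
  show "?D \<subseteq> ?H"
  proof clarify
    fix x t :: real assume xt: "\<bar>x\<bar> + \<bar>t\<bar> \<le> b"
    define P Q where "P = (if x \<ge> 0 then (b, 0::real) else (- b, 0))"
      and "Q = (if t \<ge> 0 then (0::real, b) else (0, - b))"
    have "P \<in> ?H" "Q \<in> ?H"
      by (auto simp: P_def Q_def intro: hull_inc)
    then have sub: "convex hull {P, Q, (0, 0)} \<subseteq> ?H"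
      using zero H by (intro hull_minimal) auto
    have "(x, t) = (\<bar>x\<bar> / b) *\<^sub>R P + (\<bar>t\<bar> / b) *\<^sub>R Q + (1 - \<bar>x\<bar> / b - \<bar>t\<bar> / b) *\<^sub>R (0, 0)"
      using assms by (auto simp: P_def Q_def)
    moreover have "0 \<le> 1 - \<bar>x\<bar> / b - \<bar>t\<bar> / b"
    proof -
      have "(\<bar>x\<bar> + \<bar>t\<bar>) / b \<le> b / b"
        using xt assms by (intro divide_right_mono) auto
      then show ?thesis using assms by (simp add: add_divide_distrib)
    qed
    ultimately have "(x, t) \<in> convex hull {P, Q, (0, 0)}"
      using assms unfolding convex_hull_3
      by (intro CollectI exI[of _ "\<bar>x\<bar> / b"] exI[of _ "\<bar>t\<bar> / b"] exI[of _ "1 - \<bar>x\<bar> / b - \<bar>t\<bar> / b"]) auto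
    then show "(x, t) \<in> ?H" using sub by blast
  qed
qed

lemma open_square_eq:
  assumes "b > 0"
  shows "open_square b = {(x, t). \<bar>x\<bar> + \<bar>t\<bar> < b}"
proof -
  let ?D = "{(x, t). \<bar>x\<bar> + \<bar>t\<bar> \<le> b}" and ?O = "{(x, t). \<bar>x\<bar> + \<bar>t\<bar> < b}"
  have "open {p::real \<times> real. \<bar>fst p\<bar> + \<bar>snd p\<bar> < b}"
    by (intro open_Collect_less continuous_intros)
  then have "open ?O" by (simp add: case_prod_beta')
  then have "?O \<subseteq> interior ?D"
    by (intro interior_maximal) auto
  moreover have "interior ?D \<subseteq> ?O"
  proof
    fix p assume p: "p \<in> interior ?D"
    then obtain e where e: "e > 0" "ball p e \<subseteq> ?D"
      unfolding mem_interior by blast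
    \<comment> \<open>A point of the interior may be stretched slightly away from the origin.\<close>
    define d where "d = e / (2 * (norm p + 1))"
    have d: "d > 0" using e by (auto simp: d_def intro!: divide_pos_pos add_nonneg_pos)
    have "d * norm p < e"
    proof -
      have "d * norm p \<le> d * (norm p + 1)" using d by simp
      also have "\<dots> = e / 2"
      proof -
        have "norm p + 1 > 0" by (simp add: add_nonneg_pos)
        then show ?thesis unfolding d_def by (simp add: divide_simps)
      qed
      finally show ?thesis using e by simp
    qed
    then have "(1 + d) *\<^sub>R p \<in> ball p e"
      using d by (simp add: dist_norm scaleR_left_distrib)
    then have "(1 + d) *\<^sub>R p \<in> ?D" by (rule subsetD[OF e(2)])
    then have "(1 + d) * (\<bar>fst p\<bar> + \<bar>snd p\<bar>) \<le> b"
      using d by (simp add: case_prod_beta abs_mult distrib_left)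
    moreover have "\<bar>fst p\<bar> + \<bar>snd p\<bar> < (1 + d) * (\<bar>fst p\<bar> + \<bar>snd p\<bar>)" if "\<bar>fst p\<bar> + \<bar>snd p\<bar> \<ge> b"
      using mult_strict_right_mono[of 1 "1 + d" "\<bar>fst p\<bar> + \<bar>snd p\<bar>"] d that assms by simp
    ultimately have "\<bar>fst p\<bar> + \<bar>snd p\<bar> < b" by linarith
    then show "p \<in> ?O" by (simp add: case_prod_beta)
  qed
  ultimately show ?thesis
    unfolding open_square_def convex_hull_diamond[OF assms] by blast
qed

lemma closure_open_square:
  assumes "b > 0"
  shows "closure (open_square b) = {(x, t). \<bar>x\<bar> + \<bar>t\<bar> \<le> b}"
proof -
  let ?H = "convex hull {(b, 0), (- b, 0), (0, b), (0, - b)} :: (real \<times> real) set"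
  have "(0, 0) \<in> open_square b"
    using assms by (simp add: open_square_eq)
  then have "closure (interior ?H) = closure ?H"
    by (intro convex_closure_interior) (auto simp: open_square_def)
  also have "closure ?H = ?H"
    by (intro closure_closed compact_imp_closed finite_imp_compact_convex_hull) auto
  finally show ?thesis
    using convex_hull_diamond[OF assms] by (simp add: open_square_def)
qed

lemma open_open_square: "open (open_square b)"
  by (simp add: open_square_def)

lemma compact_closure_open_square:
  assumes "b > 0"
  shows "compact (closure (open_square b))"
proof -
  have "compact (convex hull {(b, 0), (- b, 0), (0, b), (0, - b)})"
    by (intro finite_imp_compact_convex_hull) auto
  then show ?thesis
    by (simp add: closure_open_square[OF assms] convex_hull_diamond[OF assms])
qed

section \<open>The first-order system of Riemann invariants\<close>

text \<open>
  A solution \<open>w\<close> of \<open>w\<^sub>x\<^sub>x - q w = w\<^sub>t\<^sub>t\<close> satisfies this with the Riemann invariants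
  \<open>v = w\<^sub>x + w\<^sub>t\<close> and \<open>z = w\<^sub>x - w\<^sub>t\<close>.  Only derivatives in \<open>x\<close> and along the two characteristic directions occur, so
  the system makes sense without second derivatives of \<open>w\<close>.  Boundedness of \<open>v\<close> and \<open>z\<close> makes the
  weighted supremum in the stability estimate finite.
\<close>
definition riemann_system ::
  "(real \<Rightarrow> complex) \<Rightarrow> real \<Rightarrow> (real \<times> real \<Rightarrow> complex) \<Rightarrow> (real \<times> real \<Rightarrow> complex)
    \<Rightarrow> (real \<times> real \<Rightarrow> complex) \<Rightarrow> bool" where
  "riemann_system q b w v z \<longleftrightarrow>
     continuous_on (closure (open_square b)) w \<and>
     bounded (v ` open_square b) \<and> bounded (z ` open_square b) \<and>
     (\<forall>x t. (x, t) \<in> open_square b \<longrightarrow>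
        ((\<lambda>s. w (x + s, t)) has_vector_derivative (v (x, t) + z (x, t)) / 2) (at 0) \<and>
        ((\<lambda>s. v (x + s, t - s)) has_vector_derivative q x * w (x, t)) (at 0) \<and>
        ((\<lambda>s. z (x + s, t + s)) has_vector_derivative q x * w (x, t)) (at 0))"

lemma riemann_system_zero: "riemann_system q b (\<lambda>p. 0) (\<lambda>p. 0) (\<lambda>p. 0)"
proof -
  have "bounded ((\<lambda>p. 0 :: complex) ` open_square b)"
    by (rule boundedI[of _ 0]) auto
  then show ?thesis by (simp add: riemann_system_def)
qed

lemma riemann_system_add:
  assumes "riemann_system q b w v z" "riemann_system q b w' v' z'"
  shows "riemann_system q b (\<lambda>p. w p + w' p) (\<lambda>p. v p + v' p) (\<lambda>p. z p + z' p)"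
proof -
  have "((\<lambda>s. w (x + s, t) + w' (x + s, t)) has_vector_derivative
          (v (x, t) + v' (x, t) + (z (x, t) + z' (x, t))) / 2) (at 0)"
    "((\<lambda>s. v (x + s, t - s) + v' (x + s, t - s)) has_vector_derivative
          q x * (w (x, t) + w' (x, t))) (at 0)"
    "((\<lambda>s. z (x + s, t + s) + z' (x + s, t + s)) has_vector_derivative
          q x * (w (x, t) + w' (x, t))) (at 0)"
    if xt: "(x, t) \<in> open_square b" for x t
  proof -
    have eq: "(v (x, t) + v' (x, t) + (z (x, t) + z' (x, t))) / 2
        = (v (x, t) + z (x, t)) / 2 + (v' (x, t) + z' (x, t)) / 2"
      by (simp add: add_divide_distrib)
    show "((\<lambda>s. w (x + s, t) + w' (x + s, t)) has_vector_derivative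
          (v (x, t) + v' (x, t) + (z (x, t) + z' (x, t))) / 2) (at 0)"
      unfolding eq using assms xt
      by (intro has_vector_derivative_add) (simp_all add: riemann_system_def)
    show "((\<lambda>s. v (x + s, t - s) + v' (x + s, t - s)) has_vector_derivative
          q x * (w (x, t) + w' (x, t))) (at 0)"
      unfolding distrib_left using assms xt
      by (intro has_vector_derivative_add) (simp_all add: riemann_system_def)
    show "((\<lambda>s. z (x + s, t + s) + z' (x + s, t + s)) has_vector_derivative
          q x * (w (x, t) + w' (x, t))) (at 0)"
      unfolding distrib_left using assms xt
      by (intro has_vector_derivative_add) (simp_all add: riemann_system_def)
  qed
  moreover have "bounded ((\<lambda>p. v p + v' p) ` open_square b)"
    "bounded ((\<lambda>p. z p + z' p) ` open_square b)"
    using assms by (auto simp: riemann_system_def intro: bounded_plus_comp)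
  moreover have "continuous_on (closure (open_square b)) (\<lambda>p. w p + w' p)"
    using assms unfolding riemann_system_def by (intro continuous_intros) blast+
  ultimately show ?thesis
    unfolding riemann_system_def by blast
qed

lemma riemann_system_cmult:
  assumes "riemann_system q b w v z"
  shows "riemann_system q b (\<lambda>p. c * w p) (\<lambda>p. c * v p) (\<lambda>p. c * z p)"
proof -
  have "((\<lambda>s. c * w (x + s, t)) has_vector_derivative (c * v (x, t) + c * z (x, t)) / 2) (at 0)"
    "((\<lambda>s. c * v (x + s, t - s)) has_vector_derivative q x * (c * w (x, t))) (at 0)"
    "((\<lambda>s. c * z (x + s, t + s)) has_vector_derivative q x * (c * w (x, t))) (at 0)"
    if xt: "(x, t) \<in> open_square b" for x t
  proof -
    have eq: "(c * v (x, t) + c * z (x, t)) / 2 = c * ((v (x, t) + z (x, t)) / 2)"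
      "q x * (c * w (x, t)) = c * (q x * w (x, t))"
      by (simp_all add: distrib_left)
    show "((\<lambda>s. c * w (x + s, t)) has_vector_derivative (c * v (x, t) + c * z (x, t)) / 2) (at 0)"
      "((\<lambda>s. c * v (x + s, t - s)) has_vector_derivative q x * (c * w (x, t))) (at 0)"
      "((\<lambda>s. c * z (x + s, t + s)) has_vector_derivative q x * (c * w (x, t))) (at 0)"
      unfolding eq using assms xt
      by (intro has_vector_derivative_mult_right; simp add: riemann_system_def)+
  qed
  moreover have "bounded ((\<lambda>p. c * y p) ` open_square b)"
    if "bounded (y ` open_square b)" for y :: "real \<times> real \<Rightarrow> complex"
    using bounded_linear_image[OF that bounded_linear_mult_right[of c]] by (simp add: image_image)
  then have "bounded ((\<lambda>p. c * v p) ` open_square b)" "bounded ((\<lambda>p. c * z p) ` open_square b)"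
    using assms unfolding riemann_system_def by blast+
  moreover have "continuous_on (closure (open_square b)) (\<lambda>p. c * w p)"
    using assms unfolding riemann_system_def by (intro continuous_intros) blast+
  ultimately show ?thesis
    unfolding riemann_system_def by blast
qed

section \<open>Stability of the Cauchy problem with data on the segment x = 0\<close>

text \<open>
  The segment \<open>s \<mapsto> (s x, t - c (1 - s) x)\<close>, \<open>0 \<le> s \<le> 1\<close>, has slope \<open>c\<close>, starts on the axis \<open>x = 0\<close>,
  ends at \<open>(x, t)\<close> and stays in the square because \<open>\<bar>c\<bar> \<le> 1\<close>.  The bound is the integral of the
  derivative bound along it.  With \<open>c = 0, -1, 1\<close> it serves the three equations of the system.
\<close>
lemma bound_along_line:
  fixes g :: "real \<times> real \<Rightarrow> complex"
  assumes "b > 0" "l > 0" "\<bar>c\<bar> \<le> 1" "(x, t) \<in> open_square b"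
    and deriv: "\<And>x t. (x, t) \<in> open_square b \<Longrightarrow>
           ((\<lambda>s. g (x + s, t + c * s)) has_vector_derivative d x t) (at 0)"
    and bound: "\<And>x t. (x, t) \<in> open_square b \<Longrightarrow> norm (d x t) \<le> M * exp (l * \<bar>x\<bar>)"
    and init: "\<And>t. \<bar>t\<bar> < b \<Longrightarrow> norm (g (0, t)) \<le> e" and "M \<ge> 0"
  shows "norm (g (x, t)) \<le> e + M / l * exp (l * \<bar>x\<bar>)"
proof -
  define \<gamma> where "\<gamma> s = (s * x, t - c * ((1 - s) * x))" for s :: real
  have shift: "\<bar>s * x\<bar> + \<bar>t - c * ((1 - s) * x)\<bar> < b" if "0 \<le> s" "s \<le> 1" for s
  proof -
    have "\<bar>t - c * ((1 - s) * x)\<bar> \<le> \<bar>t\<bar> + \<bar>c\<bar> * ((1 - s) * \<bar>x\<bar>)"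
      using that by (intro order_trans[OF abs_triangle_ineq4]) (simp add: abs_mult)
    also have "\<bar>c\<bar> * ((1 - s) * \<bar>x\<bar>) \<le> 1 * ((1 - s) * \<bar>x\<bar>)"
      using that assms by (intro mult_right_mono) auto
    finally have "\<bar>s * x\<bar> + \<bar>t - c * ((1 - s) * x)\<bar> \<le> s * \<bar>x\<bar> + (\<bar>t\<bar> + (1 - s) * \<bar>x\<bar>)"
      using that by (simp add: abs_mult)
    also have "\<dots> = \<bar>x\<bar> + \<bar>t\<bar>" by (simp add: algebra_simps)
    also have "\<dots> < b" using assms by (simp add: open_square_eq)
    finally show ?thesis .
  qed
  have mem: "\<gamma> s \<in> open_square b" if "0 \<le> s" "s \<le> 1" for s
    using shift[OF that] assms(1) by (simp add: open_square_eq \<gamma>_def)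
  have dg: "((\<lambda>s. g (\<gamma> s)) has_vector_derivative x *\<^sub>R d (fst (\<gamma> s)) (snd (\<gamma> s))) (at s)"
    if s: "0 \<le> s" "s \<le> 1" for s
  proof -
    let ?h = "\<lambda>\<sigma>. (\<sigma> - s) * x"
    have 1: "(?h has_vector_derivative x) (at s)"
      by (auto intro!: derivative_eq_intros)
    have 2: "((\<lambda>r. g (fst (\<gamma> s) + r, snd (\<gamma> s) + c * r)) has_vector_derivative
              d (fst (\<gamma> s)) (snd (\<gamma> s))) (at (?h s))"
      using deriv[of "fst (\<gamma> s)" "snd (\<gamma> s)"] mem[OF s] by simp
    have "(\<lambda>r. g (fst (\<gamma> s) + r, snd (\<gamma> s) + c * r)) \<circ> ?h = (\<lambda>s. g (\<gamma> s))"
      by (rule ext) (simp add: \<gamma>_def algebra_simps)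
    then show ?thesis
      using vector_diff_chain_at[OF 1 2] by simp
  qed
  have "norm (g (\<gamma> 1) - g (\<gamma> 0)) \<le> M / l * exp (l * (1 * \<bar>x\<bar>)) - M / l * exp (l * (0 * \<bar>x\<bar>))"
  proof (rule differentiable_bound_general[where f = "\<lambda>s. g (\<gamma> s)"
        and f' = "\<lambda>s. x *\<^sub>R d (fst (\<gamma> s)) (snd (\<gamma> s))"
        and \<phi>' = "\<lambda>s. \<bar>x\<bar> * (M * exp (l * (s * \<bar>x\<bar>)))"])
    show "continuous_on {0..1} (\<lambda>s. g (\<gamma> s))"
      using dg by (intro continuous_at_imp_continuous_on ballI has_vector_derivative_continuous) auto
    show "((\<lambda>s. M / l * exp (l * (s * \<bar>x\<bar>))) has_vector_derivative
            \<bar>x\<bar> * (M * exp (l * (s * \<bar>x\<bar>)))) (at s)" for s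
      unfolding has_real_derivative_iff_has_vector_derivative[symmetric]
      using assms(2) by (auto intro!: derivative_eq_intros)
    show "norm (x *\<^sub>R d (fst (\<gamma> s)) (snd (\<gamma> s))) \<le> \<bar>x\<bar> * (M * exp (l * (s * \<bar>x\<bar>)))"
      if "0 < s" "s < 1" for s
    proof -
      have "norm (d (fst (\<gamma> s)) (snd (\<gamma> s))) \<le> M * exp (l * \<bar>fst (\<gamma> s)\<bar>)"
        using mem[of s] that by (intro bound) auto
      also have "\<bar>fst (\<gamma> s)\<bar> = s * \<bar>x\<bar>"
        using that by (simp add: \<gamma>_def abs_mult)
      finally show ?thesis by (simp add: mult_left_mono)
    qed
    show "continuous_on {0..1} (\<lambda>s. M / l * exp (l * (s * \<bar>x\<bar>)))"
      by (intro continuous_intros)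
  qed (use dg in auto)
  moreover have "\<gamma> 1 = (x, t)" by (simp add: \<gamma>_def)
  moreover have "norm (g (\<gamma> 0)) \<le> e"
    using shift[of 0] by (auto simp: \<gamma>_def intro!: init)
  moreover have "norm (g (x, t)) \<le> norm (g (x, t) - g (\<gamma> 0)) + norm (g (\<gamma> 0))"
    by (metis diff_add_cancel norm_triangle_ineq)
  moreover have "M / l \<ge> 0" using assms by simp
  ultimately show ?thesis by simp
qed

text \<open>
  Let \<open>N\<close> be the supremum over the square of \<open>max \<bar>w\<bar> \<bar>v\<bar> \<bar>z\<bar>\<close> times \<open>exp (- l \<bar>x\<bar>)\<close>.  Inserting
  \<open>N\<close> into the right-hand sides and integrating from the axis gains a factor \<open>1 / l\<close>, and
  \<open>l = 2 Q + 2\<close> turns this into \<open>N \<le> e + N / 2\<close>.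
\<close>
lemma riemann_system_stability:
  assumes "b > 0" and sys: "riemann_system q b w v z"
    and Q: "\<And>x. \<bar>x\<bar> \<le> b \<Longrightarrow> norm (q x) \<le> Q" and "e \<ge> 0"
    and init: "\<And>t. \<bar>t\<bar> < b \<Longrightarrow> norm (w (0, t)) \<le> e \<and> norm (v (0, t)) \<le> e \<and> norm (z (0, t)) \<le> e"
    and p: "p \<in> closure (open_square b)"
  shows "norm (w p) \<le> 2 * e * exp ((2 * Q + 2) * b)"
proof -
  let ?S = "open_square b"
  define l where "l = 2 * Q + 2"
  have "Q \<ge> 0" using Q[of 0] assms(1) by (simp add: order_trans[OF norm_ge_zero])
  then have l: "l > 0" "1 / l \<le> 1 / 2" "Q / l \<le> 1 / 2" by (auto simp: l_def field_simps)
  define m where "m p = max (norm (w p)) (max (norm (v p)) (norm (z p))) * exp (- l * \<bar>fst p\<bar>)" for p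
  have m_le: "m p \<le> c \<longleftrightarrow> norm (w p) \<le> c * exp (l * \<bar>fst p\<bar>) \<and> norm (v p) \<le> c * exp (l * \<bar>fst p\<bar>)
        \<and> norm (z p) \<le> c * exp (l * \<bar>fst p\<bar>)" for p c
    by (auto simp: m_def exp_minus divide_inverse[symmetric] pos_divide_le_eq)
  have "bounded (w ` closure ?S)"
    using sys compact_closure_open_square[OF assms(1)]
    by (auto simp: riemann_system_def intro!: compact_imp_bounded compact_continuous_image)
  then have "bounded (w ` ?S)"
    by (rule bounded_subset) (use closure_subset in blast)
  then obtain Bw Bv Bz where B: "\<And>p. p \<in> ?S \<Longrightarrow> norm (w p) \<le> Bw"
     "\<And>p. p \<in> ?S \<Longrightarrow> norm (v p) \<le> Bv" "\<And>p. p \<in> ?S \<Longrightarrow> norm (z p) \<le> Bz"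
    using sys unfolding riemann_system_def bounded_iff by (metis imageI)
  have "m p \<le> max Bw (max Bv Bz)" if "p \<in> ?S" for p
  proof -
    have nn: "0 \<le> max (norm (w p)) (max (norm (v p)) (norm (z p)))"
      by (simp add: le_max_iff_disj)
    have "m p \<le> max (norm (w p)) (max (norm (v p)) (norm (z p))) * 1"
      unfolding m_def using l nn by (intro mult_left_mono) auto
    also have "\<dots> \<le> max Bw (max Bv Bz)" using B[OF that] by (auto simp: le_max_iff_disj)
    finally show ?thesis .
  qed
  then have bdd: "bdd_above (m ` ?S)" by (rule bdd_aboveI2)
  define N where "N = (SUP p\<in>?S. m p)"
  have S0: "(0, 0) \<in> ?S" using assms(1) by (simp add: open_square_eq)
  have mN: "m p \<le> N" if "p \<in> ?S" for p
    unfolding N_def using bdd that by (rule cSUP_upper2) auto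
  have "0 \<le> m (0, 0)" by (auto simp: m_def le_max_iff_disj)
  with mN[OF S0] have N0: "N \<ge> 0" by linarith
  have growth: "norm (w (x, t)) \<le> N * exp (l * \<bar>x\<bar>)" "norm (v (x, t)) \<le> N * exp (l * \<bar>x\<bar>)"
      "norm (z (x, t)) \<le> N * exp (l * \<bar>x\<bar>)" if "(x, t) \<in> ?S" for x t
    using mN[OF that] unfolding m_le by auto
  have qw: "norm (q x * w (x, t)) \<le> Q * N * exp (l * \<bar>x\<bar>)" if "(x, t) \<in> ?S" for x t
  proof -
    have "\<bar>x\<bar> \<le> b" using that assms(1) by (simp add: open_square_eq)
    then show ?thesis
      using growth(1)[OF that] Q[of x] \<open>Q \<ge> 0\<close> by (simp add: norm_mult mult.assoc mult_mono)
  qed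
  have vz: "norm ((v (x, t) + z (x, t)) / 2) \<le> N * exp (l * \<bar>x\<bar>)" if "(x, t) \<in> ?S" for x t
    using growth[OF that] norm_triangle_ineq[of "v (x, t)" "z (x, t)"] by (simp add: norm_divide)
  have contract: "m (x, t) \<le> e + N / 2" if xt: "(x, t) \<in> ?S" for x t
  proof -
    let ?E = "exp (l * \<bar>x\<bar>)"
    have E: "?E \<ge> 1" using l by simp
    have step: "e + M / l * ?E \<le> (e + N / 2) * ?E" if "M / l \<le> N / 2" for M
    proof -
      have "e * 1 \<le> e * ?E" using E assms(4) by (rule mult_left_mono)
      moreover have "M / l * ?E \<le> N / 2 * ?E" using that by (rule mult_right_mono) simp
      ultimately show ?thesis unfolding distrib_right by linarith
    qed
    have "norm (w (x, t)) \<le> e + N / l * ?E"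
      using sys vz init N0
      by (intro bound_along_line[OF assms(1) l(1) _ xt, where c = 0])
        (auto simp: riemann_system_def)
    moreover have "norm (v (x, t)) \<le> e + Q * N / l * ?E"
      using sys qw init N0 \<open>Q \<ge> 0\<close>
      by (intro bound_along_line[OF assms(1) l(1) _ xt, where c = "-1" and d = "\<lambda>x t. q x * w (x, t)"])
        (auto simp: riemann_system_def)
    moreover have "norm (z (x, t)) \<le> e + Q * N / l * ?E"
      using sys qw init N0 \<open>Q \<ge> 0\<close>
      by (intro bound_along_line[OF assms(1) l(1) _ xt, where c = 1 and d = "\<lambda>x t. q x * w (x, t)"])
        (auto simp: riemann_system_def)
    moreover have "N / l \<le> N / 2" "Q * N / l \<le> N / 2"
      using mult_right_mono[OF l(2) N0] mult_right_mono[OF l(3) N0] by auto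
    ultimately show ?thesis
      unfolding m_le using step[of N] step[of "Q * N"] by auto
  qed
  have "N \<le> e + N / 2"
    unfolding N_def[symmetric] using S0 contract
    by (subst N_def, intro cSUP_least) auto
  then have N: "N \<le> 2 * e" by simp
  have "norm (w p) \<le> 2 * e * exp (l * b)" if "p \<in> ?S" for p
  proof -
    obtain x t where p: "p = (x, t)" by fastforce
    have "norm (w p) \<le> N * exp (l * \<bar>x\<bar>)" using growth(1) that p by simp
    also have "\<dots> \<le> 2 * e * exp (l * b)"
      using that p N N0 l assms by (intro mult_mono) (auto simp: open_square_eq)
    finally show ?thesis .
  qed
  then show ?thesis
    using continuous_on_closure_norm_le[of ?S w "2 * e * exp (l * b)" p] sys p
    by (auto simp: riemann_system_def l_def)
qed

section \<open>A classical solution satisfies the first-order system\<close>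

lemma norm_increment_le:
  fixes g :: "real \<Rightarrow> 'a::real_normed_vector"
  assumes "a \<le> c" and "\<And>s. a \<le> s \<Longrightarrow> s \<le> c \<Longrightarrow> (g has_vector_derivative g' s) (at s)"
    and "\<And>s. a \<le> s \<Longrightarrow> s \<le> c \<Longrightarrow> norm (g' s) \<le> B"
  shows "norm (g c - g a) \<le> B * (c - a)"
proof (cases "a = c")
  case False
  then have "a < c" using assms(1) by simp
  then have "norm (g c - g a) \<le> B * c - B * a"
  proof (rule differentiable_bound_general[where f' = g' and \<phi>' = "\<lambda>s. B"])
    show "continuous_on {a..c} g"
      using assms(2)
      by (intro continuous_at_imp_continuous_on ballI has_vector_derivative_continuous) auto
    show "((*) B has_vector_derivative B) (at s)" for s
      unfolding has_real_derivative_iff_has_vector_derivative[symmetric]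
      by (auto intro!: derivative_eq_intros)
  qed (use assms in \<open>auto intro!: continuous_intros\<close>)
  then show ?thesis by (simp add: algebra_simps)
qed simp

text \<open>
  The second difference of \<open>F\<close> over a square of side \<open>h\<close> is \<open>h\<^sup>2\<close> times the mixed derivative, up to
  its oscillation: apply the mean value inequality first in \<open>t\<close> and then in \<open>x\<close>.
\<close>
lemma second_difference_le:
  fixes F Fx Fxt :: "real \<Rightarrow> real \<Rightarrow> 'a::real_normed_vector"
  assumes "h \<ge> 0"
    and dx: "\<And>s r. s \<in> {x..x+h} \<Longrightarrow> r \<in> {t..t+h} \<Longrightarrow> ((\<lambda>s. F s r) has_vector_derivative Fx s r) (at s)"
    and dt: "\<And>s r. s \<in> {x..x+h} \<Longrightarrow> r \<in> {t..t+h} \<Longrightarrow> ((\<lambda>r. Fx s r) has_vector_derivative Fxt s r) (at r)"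
    and close: "\<And>s r. s \<in> {x..x+h} \<Longrightarrow> r \<in> {t..t+h} \<Longrightarrow> norm (Fxt s r - A) \<le> e"
  shows "norm (F (x+h) (t+h) - F (x+h) t - F x (t+h) + F x t - (h * h) *\<^sub>R A) \<le> e * h * h"
proof -
  have inner: "norm (Fx s (t+h) - Fx s t - h *\<^sub>R A) \<le> e * h" if s: "s \<in> {x..x+h}" for s
  proof -
    have "norm ((Fx s (t+h) - (t+h) *\<^sub>R A) - (Fx s t - t *\<^sub>R A)) \<le> e * ((t + h) - t)"
    proof (rule norm_increment_le[where g' = "\<lambda>r. Fxt s r - A"])
      show "((\<lambda>r. Fx s r - r *\<^sub>R A) has_vector_derivative Fxt s r - A) (at r)"
        if "t \<le> r" "r \<le> t + h" for r
        using dt[OF s, of r] that by (auto intro!: derivative_eq_intros)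
    qed (use close s assms(1) in auto)
    then show ?thesis by (simp add: algebra_simps)
  qed
  have "norm ((F (x+h) (t+h) - F (x+h) t - (x+h) *\<^sub>R h *\<^sub>R A) - (F x (t+h) - F x t - x *\<^sub>R h *\<^sub>R A))
        \<le> (e * h) * ((x + h) - x)"
  proof (rule norm_increment_le[where g' = "\<lambda>s. Fx s (t+h) - Fx s t - h *\<^sub>R A"])
    show "((\<lambda>s. F s (t+h) - F s t - s *\<^sub>R h *\<^sub>R A) has_vector_derivative
            Fx s (t+h) - Fx s t - h *\<^sub>R A) (at s)"
      if "x \<le> s" "s \<le> x + h" for s
    proof -
      have "((\<lambda>s. s *\<^sub>R h *\<^sub>R A) has_vector_derivative h *\<^sub>R A) (at s)"
        by (auto intro!: derivative_eq_intros)
      then show ?thesis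
        using that assms(1) by (intro has_vector_derivative_diff dx) auto
    qed
  qed (use inner assms(1) in auto)
  then show ?thesis by (simp add: algebra_simps)
qed

text \<open>
  The second difference is symmetric in the two variables, so by the previous estimate, applied in
  both orders on a small square, it determines both mixed derivatives.
\<close>
lemma mixed_partials_eq:
  fixes F Fx Ft Fxt Ftx :: "real \<Rightarrow> real \<Rightarrow> 'a::real_normed_vector"
  assumes "open S" "(x, t) \<in> S"
    and Fx: "\<And>s r. (s, r) \<in> S \<Longrightarrow> ((\<lambda>s. F s r) has_vector_derivative Fx s r) (at s)"
    and Ft: "\<And>s r. (s, r) \<in> S \<Longrightarrow> ((\<lambda>r. F s r) has_vector_derivative Ft s r) (at r)"
    and Fxt: "\<And>s r. (s, r) \<in> S \<Longrightarrow> ((\<lambda>r. Fx s r) has_vector_derivative Fxt s r) (at r)"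
    and Ftx: "\<And>s r. (s, r) \<in> S \<Longrightarrow> ((\<lambda>s. Ft s r) has_vector_derivative Ftx s r) (at s)"
    and cont: "continuous_on S (\<lambda>(s, r). Fxt s r)" "continuous_on S (\<lambda>(s, r). Ftx s r)"
  shows "Fxt x t = Ftx x t"
proof (rule ccontr)
  assume ne: "Fxt x t \<noteq> Ftx x t"
  \<comment> \<open>Two errors of size \<open>e\<close> must not add up to the supposed gap.\<close>
  define e where "e = norm (Fxt x t - Ftx x t) / 3"
  have e: "e > 0" using ne by (simp add: e_def)
  have "isCont (\<lambda>(s, r). Fxt s r) (x, t)" "isCont (\<lambda>(s, r). Ftx s r) (x, t)"
    using cont assms(1,2) by (auto simp: continuous_on_eq_continuous_at)
  moreover have "\<forall>\<^sub>F p in nhds (x, t). dist (g p) (g (x, t)) < e"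
    if "isCont g (x, t)" for g :: "real \<times> real \<Rightarrow> 'a"
    using that e unfolding isCont_def tendsto_at_iff_tendsto_nhds by (rule tendstoD)
  ultimately have "\<forall>\<^sub>F p in nhds (x, t). dist (case p of (s, r) \<Rightarrow> Fxt s r) (Fxt x t) < e"
    "\<forall>\<^sub>F p in nhds (x, t). dist (case p of (s, r) \<Rightarrow> Ftx s r) (Ftx x t) < e"
    by fastforce+
  moreover have "\<forall>\<^sub>F p in nhds (x, t). p \<in> S"
    using assms(1,2) by (rule eventually_nhds_in_open)
  ultimately have "\<forall>\<^sub>F p in nhds (x, t). p \<in> S \<and> dist (case p of (s, r) \<Rightarrow> Fxt s r) (Fxt x t) < e
      \<and> dist (case p of (s, r) \<Rightarrow> Ftx s r) (Ftx x t) < e"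
    by eventually_elim simp
  then obtain d where d: "d > 0" and near: "\<And>p. dist p (x, t) < d \<Longrightarrow> p \<in> S
      \<and> dist (case p of (s, r) \<Rightarrow> Fxt s r) (Fxt x t) < e \<and> dist (case p of (s, r) \<Rightarrow> Ftx s r) (Ftx x t) < e"
    unfolding eventually_nhds_metric by blast
  \<comment> \<open>A square of side \<open>d / 3\<close> with corner \<open>(x, t)\<close> lies in the ball of radius \<open>d\<close>.\<close>
  define h where "h = d / 3"
  have h: "h > 0" using d by (simp add: h_def)
  have box: "dist (s, r) (x, t) < d" if "s \<in> {x..x+h}" "r \<in> {t..t+h}" for s r
  proof -
    have "dist (s, r) (x, t) \<le> \<bar>s - x\<bar> + \<bar>r - t\<bar>"
      using sqrt_sum_squares_le_sum_abs[of "s - x" "r - t"] by (simp add: dist_Pair_Pair dist_real_def)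
    also have "\<dots> \<le> h + h" using that by (intro add_mono) auto
    also have "\<dots> < d" using d by (simp add: h_def)
    finally show ?thesis .
  qed
  note near' = near[OF box]
  have "norm (F (x+h) (t+h) - F (x+h) t - F x (t+h) + F x t - (h * h) *\<^sub>R Fxt x t) \<le> e * h * h"
    using near' h
    by (intro second_difference_le[where Fx = Fx and Fxt = Fxt] Fx Fxt)
      (auto simp: dist_norm intro: less_imp_le)
  moreover have "norm (F (x+h) (t+h) - F x (t+h) - F (x+h) t + F x t - (h * h) *\<^sub>R Ftx x t) \<le> e * h * h"
    using near' h
    by (intro second_difference_le[where F = "\<lambda>r s. F s r" and Fx = "\<lambda>r s. Ft s r"
          and Fxt = "\<lambda>r s. Ftx s r"] Ft Ftx)
      (auto simp: dist_norm intro: less_imp_le)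
  moreover have eq: "(h * h) *\<^sub>R (Fxt x t - Ftx x t)
      = (F (x+h) (t+h) - F x (t+h) - F (x+h) t + F x t - (h * h) *\<^sub>R Ftx x t)
      - (F (x+h) (t+h) - F (x+h) t - F x (t+h) + F x t - (h * h) *\<^sub>R Fxt x t)" (is "_ = ?B - ?A")
    by (simp add: scaleR_right_diff_distrib)
  moreover have "norm (?B - ?A) \<le> norm ?B + norm ?A"
    by (rule norm_triangle_ineq4)
  ultimately have "norm (?B - ?A) \<le> e * h * h + e * h * h"
    by linarith
  then have "norm ((h * h) *\<^sub>R (Fxt x t - Ftx x t)) \<le> e * h * h + e * h * h"
    by (simp only: eq)
  then have "(h * h) * (3 * e) \<le> (h * h) * (2 * e)"
    unfolding norm_scaleR by (simp add: e_def algebra_simps)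
  then show False using h e by (simp add: mult_le_cancel_left)
qed

lemma derivative_along_line:
  fixes F Fx Ft :: "real \<Rightarrow> real \<Rightarrow> complex"
  assumes "open S" "(x, t) \<in> S"
    and Fx: "\<And>s r. (s, r) \<in> S \<Longrightarrow> ((\<lambda>s. F s r) has_vector_derivative Fx s r) (at s)"
    and Ft: "\<And>s r. (s, r) \<in> S \<Longrightarrow> ((\<lambda>r. F s r) has_vector_derivative Ft s r) (at r)"
    and cont: "continuous_on S (\<lambda>(s, r). Ft s r)"
  shows "((\<lambda>s. F (x + s) (t + c * s)) has_vector_derivative Fx x t + c *\<^sub>R Ft x t) (at 0)"
proof -
  obtain X Y where XY: "open X" "open Y" "x \<in> X" "t \<in> Y" "X \<times> Y \<subseteq> S"
    using assms(1,2) by (auto elim!: open_prod_elim)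
  obtain e where e: "e > 0" "ball t e \<subseteq> Y" using XY by (meson openE)
  have "((\<lambda>(x, t). F x t) has_derivative
          (\<lambda>(tx, ty). tx *\<^sub>R Fx x t + blinfun_scaleR_left (Ft x t) ty)) (at (x, t) within X \<times> ball t e)"
  proof (rule has_derivative_partialsI)
    show "((\<lambda>x. F x t) has_derivative (\<lambda>tx. tx *\<^sub>R Fx x t)) (at x within X)"
      using Fx[of x t] assms(2)
      by (auto simp: has_vector_derivative_def intro: has_derivative_at_withinI)
    show "((\<lambda>t. F x t) has_derivative blinfun_apply (blinfun_scaleR_left (Ft x y))) (at y within ball t e)"
      if "x \<in> X" "y \<in> ball t e" for x y
    proof -
      have "(x, y) \<in> S" using XY e that by blast
      from Ft[OF this] have "(F x has_derivative (\<lambda>h. h *\<^sub>R Ft x y)) (at y)"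
        by (simp add: has_vector_derivative_def)
      then show ?thesis
        by (simp add: has_derivative_at_withinI)
    qed
    have "isCont (\<lambda>(s, r). Ft s r) (x, t)"
      using cont assms(1,2) by (auto simp: continuous_on_eq_continuous_at)
    then have "isCont (\<lambda>p. blinfun_scaleR_left (case p of (s, r) \<Rightarrow> Ft s r)) (x, t)"
      by (intro bounded_linear.isCont[OF bounded_linear_blinfun_scaleR_left])
    then show "continuous (at (x, t) within X \<times> ball t e) (\<lambda>(x, y). blinfun_scaleR_left (Ft x y))"
      unfolding case_prod_beta by (rule continuous_at_imp_continuous_at_within)
  qed (use e in auto)
  then have D: "((\<lambda>(x, t). F x t) has_derivative (\<lambda>(tx, ty). tx *\<^sub>R Fx x t + ty *\<^sub>R Ft x t)) (at (x, t))"
    using XY e at_within_open[of "(x, t)" "X \<times> ball t e"]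
    by (simp add: open_Times case_prod_beta)
  have "((\<lambda>s. (x + s, t + c * s)) has_derivative (\<lambda>s. (s, c * s))) (at 0)"
    by (auto intro!: derivative_eq_intros)
  from has_derivative_compose[OF this, of "\<lambda>(x, t). F x t" "\<lambda>(tx, ty). tx *\<^sub>R Fx x t + ty *\<^sub>R Ft x t"] D
  show ?thesis by (simp add: has_vector_derivative_def algebra_simps)
qed

lemma has_vector_derivative_partial_x:
  assumes "has_partials_on u S" "(s, r) \<in> S"
  shows "((\<lambda>s. u (s, r)) has_vector_derivative partial_x u (s, r)) (at s)"
  using bspec[OF assms(1)[unfolded has_partials_on_def] assms(2), unfolded prod.case, THEN conjunct1]
  unfolding partial_x_def fst_conv snd_conv by (rule vector_derivative_works[THEN iffD1])

lemma has_vector_derivative_partial_t: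
  assumes "has_partials_on u S" "(s, r) \<in> S"
  shows "((\<lambda>r. u (s, r)) has_vector_derivative partial_t u (s, r)) (at r)"
  using bspec[OF assms(1)[unfolded has_partials_on_def] assms(2), unfolded prod.case, THEN conjunct2]
  unfolding partial_t_def fst_conv snd_conv by (rule vector_derivative_works[THEN iffD1])

lemma extends_continuously_imp_continuous_on:
  assumes "extends_continuously v S"
  shows "continuous_on S v"
proof -
  obtain g where "continuous_on (closure S) g" "\<And>p. p \<in> S \<Longrightarrow> g p = v p"
    using assms by (auto simp: extends_continuously_def)
  then show ?thesis
    using continuous_on_subset[OF _ closure_subset] continuous_on_cong by metis
qed

lemma extends_continuously_imp_bounded:
  assumes "extends_continuously v S" "compact (closure S)"
  shows "bounded (v ` S)"
proof -
  obtain g where g: "continuous_on (closure S) g" "\<And>p. p \<in> S \<Longrightarrow> g p = v p"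
    using assms by (auto simp: extends_continuously_def)
  then have "bounded (g ` closure S)"
    using assms(2) by (intro compact_imp_bounded compact_continuous_image)
  moreover have "v ` S \<subseteq> g ` closure S"
    using g(2) closure_subset[of S] by (force simp: image_iff)
  ultimately show ?thesis by (rule bounded_subset)
qed

text \<open>
  \<open>(\<partial>\<^sub>x - \<partial>\<^sub>t) (u\<^sub>x + u\<^sub>t) = u\<^sub>x\<^sub>x - u\<^sub>t\<^sub>t\<close> and \<open>(\<partial>\<^sub>x + \<partial>\<^sub>t) (u\<^sub>x - u\<^sub>t) = u\<^sub>x\<^sub>x - u\<^sub>t\<^sub>t\<close>, because the mixed
  derivatives cancel; by the equation both are \<open>q u\<close>.
\<close>
lemma riemann_system_classical_solution:
  assumes "b > 0" and C2: "C2_on_closure u (open_square b)"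
    and pde: "\<And>x t. (x, t) \<in> open_square b \<Longrightarrow>
           partial_x (partial_x u) (x, t) - q x * u (x, t) = partial_t (partial_t u) (x, t)"
  shows "riemann_system q b u (\<lambda>p. partial_x u p + partial_t u p) (\<lambda>p. partial_x u p - partial_t u p)"
proof -
  let ?S = "open_square b"
  have P: "has_partials_on u ?S" "has_partials_on (partial_x u) ?S" "has_partials_on (partial_t u) ?S"
    using C2 by (auto simp: C2_on_closure_def)
  have E: "extends_continuously v ?S" if "v \<in> {partial_x u, partial_t u, partial_x (partial_x u),
      partial_t (partial_x u), partial_x (partial_t u), partial_t (partial_t u)}" for v
    using C2 that unfolding C2_on_closure_def by blast
  note Dx = has_vector_derivative_partial_x and Dt = has_vector_derivative_partial_t
  have C: "continuous_on ?S (partial_t (partial_x u))" "continuous_on ?S (partial_x (partial_t u))"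
     "continuous_on ?S (partial_t (partial_t u))"
    by (rule extends_continuously_imp_continuous_on, rule E, simp)+
  have mixed: "partial_t (partial_x u) (x, t) = partial_x (partial_t u) (x, t)" if "(x, t) \<in> ?S" for x t
    by (rule mixed_partials_eq[OF open_open_square that, where F = "\<lambda>s r. u (s, r)"
          and Fx = "\<lambda>s r. partial_x u (s, r)" and Ft = "\<lambda>s r. partial_t u (s, r)"
          and Fxt = "\<lambda>s r. partial_t (partial_x u) (s, r)" and Ftx = "\<lambda>s r. partial_x (partial_t u) (s, r)"])
      (use C Dx[OF P(1)] Dt[OF P(1)] Dt[OF P(2)] Dx[OF P(3)] in auto)
  have line: "((\<lambda>s. partial_x u (x + s, t + c * s)) has_vector_derivative
          partial_x (partial_x u) (x, t) + c *\<^sub>R partial_t (partial_x u) (x, t)) (at 0)"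
      "((\<lambda>s. partial_t u (x + s, t + c * s)) has_vector_derivative
          partial_x (partial_t u) (x, t) + c *\<^sub>R partial_t (partial_t u) (x, t)) (at 0)"
    if "(x, t) \<in> ?S" for x t c
    using derivative_along_line[OF open_open_square that, where F = "\<lambda>s r. partial_x u (s, r)"
          and Fx = "\<lambda>s r. partial_x (partial_x u) (s, r)" and Ft = "\<lambda>s r. partial_t (partial_x u) (s, r)"]
       derivative_along_line[OF open_open_square that, where F = "\<lambda>s r. partial_t u (s, r)"
          and Fx = "\<lambda>s r. partial_x (partial_t u) (s, r)" and Ft = "\<lambda>s r. partial_t (partial_t u) (s, r)"]
      Dx[OF P(2)] Dt[OF P(2)] Dx[OF P(3)] Dt[OF P(3)] C by auto
  have "((\<lambda>s. u (x + s, t)) has_vector_derivative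
          ((partial_x u (x, t) + partial_t u (x, t)) + (partial_x u (x, t) - partial_t u (x, t))) / 2) (at 0)"
    "((\<lambda>s. partial_x u (x + s, t - s) + partial_t u (x + s, t - s)) has_vector_derivative
          q x * u (x, t)) (at 0)"
    "((\<lambda>s. partial_x u (x + s, t + s) - partial_t u (x + s, t + s)) has_vector_derivative
          q x * u (x, t)) (at 0)" if xt: "(x, t) \<in> ?S" for x t
  proof -
    have qu: "q x * u (x, t) = partial_x (partial_x u) (x, t) - partial_t (partial_t u) (x, t)"
      using pde[OF xt] by (simp add: algebra_simps)
    have "((\<lambda>s. x + s) has_vector_derivative 1) (at 0)"
      by (auto intro!: derivative_eq_intros)
    from vector_diff_chain_at[OF this, of "\<lambda>s. u (s, t)" "partial_x u (x, t)"] Dx[OF P(1) xt]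
    show "((\<lambda>s. u (x + s, t)) has_vector_derivative
        ((partial_x u (x, t) + partial_t u (x, t)) + (partial_x u (x, t) - partial_t u (x, t))) / 2) (at 0)"
      by (simp add: o_def)
    show "((\<lambda>s. partial_x u (x + s, t - s) + partial_t u (x + s, t - s)) has_vector_derivative
          q x * u (x, t)) (at 0)"
      using has_vector_derivative_add[OF line[OF xt, of "-1"]] mixed[OF xt] qu by simp
    show "((\<lambda>s. partial_x u (x + s, t + s) - partial_t u (x + s, t + s)) has_vector_derivative
          q x * u (x, t)) (at 0)"
      using has_vector_derivative_diff[OF line[OF xt, of 1]] mixed[OF xt] qu by simp
  qed
  moreover have "bounded (partial_x u ` ?S)" "bounded (partial_t u ` ?S)"
    by (rule extends_continuously_imp_bounded[OF E compact_closure_open_square[OF assms(1)]], simp)+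
  then have "bounded ((\<lambda>p. partial_x u p + partial_t u p) ` ?S)"
     "bounded ((\<lambda>p. partial_x u p - partial_t u p) ` ?S)"
    using bounded_plus_comp[of "partial_x u" ?S "partial_t u"]
      bounded_minus_comp[of "partial_x u" ?S "partial_t u"] by blast+
  moreover have "continuous_on (closure ?S) u"
    using C2 by (simp add: C2_on_closure_def)
  ultimately show ?thesis
    unfolding riemann_system_def by blast
qed

section \<open>The formal powers\<close>

definition formal_power :: "(real \<Rightarrow> complex) \<Rightarrow> nat \<Rightarrow> real \<Rightarrow> complex" where
  "formal_power f k = (if odd k then X_plain f k else X_tilde f k)"

text \<open>
  The recursive integrals of index \<open>k - 1\<close> in the same chain as \<open>formal_power f k\<close>; they carry the
  parity opposite to that of \<open>formal_power f (k - 1)\<close>.  The truncated \<open>k - 1\<close> at \<open>k = 0\<close> is harmless, as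
  the value is always multiplied by \<open>k\<close>.
\<close>
definition predecessor_power :: "(real \<Rightarrow> complex) \<Rightarrow> nat \<Rightarrow> real \<Rightarrow> complex" where
  "predecessor_power f k = (if odd k then X_plain f (k - 1) else X_tilde f (k - 1))"

text \<open>
  The derivative of \<open>\<phi>\<^sub>k\<close>: differentiating \<open>formal_power f k\<close> produces
  \<open>k * predecessor_power f k / f\<^sup>2\<close>.
\<close>
definition phi' :: "(real \<Rightarrow> complex) \<Rightarrow> (real \<Rightarrow> complex) \<Rightarrow> nat \<Rightarrow> real \<Rightarrow> complex" where
  "phi' f f' k x = f' x * formal_power f k x + of_nat k * predecessor_power f k x / f x"

lemma phi_eq: "phi f k x = f x * formal_power f k x"
  by (simp add: phi_def formal_power_def)

lemma X_at_0: "X_tilde f n 0 = (if n = 0 then 1 else 0)" "X_plain f n 0 = (if n = 0 then 1 else 0)"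
  by (cases n; simp add: interval_integral_endpoints_same zero_ereal_def)+

lemma oriented_integral_derivative:
  fixes g :: "real \<Rightarrow> complex"
  assumes "b > 0" "continuous_on {-b..b} g" "x \<in> {-b..b}"
  shows "((\<lambda>x. LBINT s=0..x. g s) has_vector_derivative g x) (at x within {-b..b})"
  using interval_integral_FTC2[of "-b" 0 b g x] assms by (simp add: zero_ereal_def)

locale nonvanishing_solution =
  fixes b :: real and f f' f'' q :: "real \<Rightarrow> complex"
  assumes b: "b > 0"
    and f': "\<And>x. x \<in> {-b..b} \<Longrightarrow> (f has_vector_derivative f' x) (at x within {-b..b})"
    and f'': "\<And>x. x \<in> {-b..b} \<Longrightarrow> (f' has_vector_derivative f'' x) (at x within {-b..b})"
    and f_eq: "\<And>x. x \<in> {-b..b} \<Longrightarrow> f'' x = q x * f x"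
    and f_nz: "\<And>x. x \<in> {-b..b} \<Longrightarrow> f x \<noteq> 0"
    and f_0: "f 0 = 1"
begin

lemma continuous_on_f: "continuous_on {-b..b} f" "continuous_on {-b..b} f'"
  unfolding continuous_on_eq_continuous_within
  by (blast intro: has_vector_derivative_continuous[OF f'] has_vector_derivative_continuous[OF f''])+

lemma continuous_on_weight: "continuous_on {-b..b} (\<lambda>x. ((f x)\<^sup>2) powi k)"
  using f_nz by (intro continuous_intros continuous_on_f) auto

lemma continuous_on_X: "continuous_on {-b..b} (X_tilde f n)" "continuous_on {-b..b} (X_plain f n)"
proof (induction n)
  case (Suc n)
  have "continuous_on {-b..b} (\<lambda>x. LBINT s=0..x. g s)"
    if "continuous_on {-b..b} g" for g :: "real \<Rightarrow> complex"
    unfolding continuous_on_eq_continuous_within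
    by (blast intro: has_vector_derivative_continuous[OF oriented_integral_derivative[OF b that]])
  note integral = this
  { case 1 show ?case
      using Suc by (auto intro!: continuous_intros integral continuous_on_weight) }
  { case 2 show ?case
      using Suc by (auto intro!: continuous_intros integral continuous_on_weight simp del: power_Suc) }
qed simp_all

lemma X_derivative:
  assumes "x \<in> {-b<..<b}"
  shows "(X_tilde f (Suc n) has_vector_derivative of_nat (Suc n) * (X_tilde f n x * ((f x)\<^sup>2) powi ((-1) ^ n))) (at x)"
    "(X_plain f (Suc n) has_vector_derivative of_nat (Suc n) * (X_plain f n x * ((f x)\<^sup>2) powi ((-1) ^ Suc n))) (at x)"
proof -
  have "((\<lambda>x. of_nat (Suc n) * (LBINT s=0..x. g s)) has_vector_derivative of_nat (Suc n) * g x) (at x)"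
    if "continuous_on {-b..b} g" for g :: "real \<Rightarrow> complex"
  proof -
    have "((\<lambda>x. LBINT s=0..x. g s) has_vector_derivative g x) (at x within {-b..b})"
      using assms by (intro oriented_integral_derivative b that) auto
    then have "((\<lambda>x. LBINT s=0..x. g s) has_vector_derivative g x) (at x)"
      using assms by (simp add: at_within_Icc_at)
    then show ?thesis by (rule has_vector_derivative_mult_right)
  qed
  note D = this
  show "(X_tilde f (Suc n) has_vector_derivative of_nat (Suc n) * (X_tilde f n x * ((f x)\<^sup>2) powi ((-1) ^ n))) (at x)"
    unfolding X_tilde.simps by (intro D continuous_intros continuous_on_X continuous_on_weight)
  show "(X_plain f (Suc n) has_vector_derivative of_nat (Suc n) * (X_plain f n x * ((f x)\<^sup>2) powi ((-1) ^ Suc n))) (at x)"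
    unfolding X_plain.simps by (intro D continuous_intros continuous_on_X continuous_on_weight)
qed

text \<open>
  The parities are matched so that for even and for odd \<open>k\<close> alike the last integration carries the
  weight \<open>1 / f\<^sup>2\<close> and the one before it the weight \<open>f\<^sup>2\<close>.
\<close>
lemma formal_power_derivative:
  assumes "x \<in> {-b<..<b}"
  shows "(formal_power f k has_vector_derivative of_nat k * predecessor_power f k x / (f x)\<^sup>2) (at x)"
proof (cases k)
  case (Suc n)
  then show ?thesis
    using X_derivative[OF assms, of n]
    by (cases "even n") (simp_all add: formal_power_def predecessor_power_def power_int_minus field_simps)
qed (simp add: formal_power_def)

lemma predecessor_power_derivative:
  assumes "x \<in> {-b<..<b}" "k > 0"
  shows "(predecessor_power f k has_vector_derivative
          of_nat (k - 1) * formal_power f (k - 2) x * (f x)\<^sup>2) (at x)"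
proof (cases "k = 1")
  case False
  then obtain n where k: "k = Suc (Suc n)"
    using assms(2) by (metis One_nat_def gr0_implies_Suc old.nat.exhaust)
  show ?thesis
    using X_derivative[OF assms(1), of n]
    by (cases "even n") (simp_all add: k formal_power_def predecessor_power_def field_simps)
qed (simp add: predecessor_power_def)

lemma f_derivatives_at:
  assumes "x \<in> {-b<..<b}"
  shows "(f has_vector_derivative f' x) (at x)" "(f' has_vector_derivative q x * f x) (at x)"
  using f'[of x] f''[of x] f_eq[of x] assms by (simp_all add: at_within_Icc_at)

lemma phi_derivative:
  assumes "x \<in> {-b<..<b}"
  shows "(phi f k has_vector_derivative phi' f f' k x) (at x)"
proof -
  have "((\<lambda>x. f x * formal_power f k x) has_vector_derivative
     f x * (of_nat k * predecessor_power f k x / (f x)\<^sup>2) + f' x * formal_power f k x) (at x)"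
    by (intro has_vector_derivative_mult f_derivatives_at formal_power_derivative assms)
  moreover have "f x \<noteq> 0" using f_nz assms by auto
  ultimately show ?thesis
    by (simp add: phi_eq[abs_def] phi'_def power2_eq_square add.commute)
qed

text \<open>
  The operator factors as \<open>\<partial>\<^sup>2 - q = (1 / f) \<partial> f\<^sup>2 \<partial> (1 / f)\<close>, and its two differentiations undo
  the last two integrations in \<open>\<phi>\<^sub>k\<close>, so that \<open>\<phi>\<^sub>k'' - q \<phi>\<^sub>k = k (k - 1) \<phi>\<^sub>k\<^sub>-\<^sub>2\<close>.
\<close>
lemma phi'_derivative:
  assumes "x \<in> {-b<..<b}"
  shows "(phi' f f' k has_vector_derivative
          q x * phi f k x + of_nat k * (of_nat (k - 1) * phi f (k - 2) x)) (at x)"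
proof -
  have nz: "f x \<noteq> 0" using f_nz assms by auto
  have 1: "((\<lambda>x. f' x * formal_power f k x) has_vector_derivative
     f' x * (of_nat k * predecessor_power f k x / (f x)\<^sup>2) + (q x * f x) * formal_power f k x) (at x)"
    by (intro has_vector_derivative_mult f_derivatives_at formal_power_derivative assms)
  have 2: "((\<lambda>x. of_nat k * predecessor_power f k x / f x) has_vector_derivative
     of_nat k * (of_nat (k - 1) * formal_power f (k - 2) x * f x)
     - f' x * (of_nat k * predecessor_power f k x / (f x)\<^sup>2)) (at x)"
  proof (cases "k = 0")
    case False
    have "((\<lambda>x. inverse (f x)) has_vector_derivative - (inverse (f x) * f' x * inverse (f x))) (at x)"
      using Deriv.has_derivative_inverse[OF nz f_derivatives_at(1)[OF assms, unfolded has_vector_derivative_def]]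
      by (simp add: has_vector_derivative_def algebra_simps)
    from has_vector_derivative_mult_right[OF has_vector_derivative_mult[OF
          predecessor_power_derivative[OF assms, of k] this], of "of_nat k"] False
    have "((\<lambda>x. of_nat k * (predecessor_power f k x * inverse (f x))) has_vector_derivative
       of_nat k * (predecessor_power f k x * - (inverse (f x) * f' x * inverse (f x))
         + of_nat (k - 1) * formal_power f (k - 2) x * (f x)\<^sup>2 * inverse (f x))) (at x)"
      by simp
    moreover have "of_nat k * (predecessor_power f k x * - (inverse (f x) * f' x * inverse (f x))
         + of_nat (k - 1) * formal_power f (k - 2) x * (f x)\<^sup>2 * inverse (f x))
      = of_nat k * (of_nat (k - 1) * formal_power f (k - 2) x * f x)
     - f' x * (of_nat k * predecessor_power f k x / (f x)\<^sup>2)"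
      using nz by (simp add: field_simps power2_eq_square)
    ultimately show ?thesis by (simp add: divide_inverse mult.assoc)
  qed simp
  from has_vector_derivative_add[OF 1 2] show ?thesis
    by (simp add: phi'_def[abs_def] phi_eq algebra_simps)
qed

lemma continuous_on_phi: "continuous_on {-b..b} (phi f k)" "continuous_on {-b..b} (phi' f f' k)"
proof -
  have "continuous_on {-b..b} (formal_power f k)" "continuous_on {-b..b} (predecessor_power f k)"
    by (simp_all add: formal_power_def predecessor_power_def continuous_on_X)
  then show "continuous_on {-b..b} (phi f k)" "continuous_on {-b..b} (phi' f f' k)"
    unfolding phi_eq[abs_def] phi'_def[abs_def] using f_nz
    by (auto intro!: continuous_intros continuous_on_f)
qed

lemma phi_at_0: "phi f k 0 = (if k = 0 then 1 else 0)"
  by (simp add: phi_def X_at_0 f_0)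

lemma phi'_at_0: "phi' f f' k 0 = (if k = 0 then f' 0 else if k = 1 then 1 else 0)"
  by (auto simp: phi'_def formal_power_def predecessor_power_def X_at_0 f_0
      simp del: X_tilde.simps(2) X_plain.simps(2))

end

section \<open>Wave polynomials as solutions\<close>

text \<open>
  With \<open>g\<^sub>k(x) = x^k\<close> this is \<open>(x + y)^n\<close>; with \<open>g = \<phi>\<close> it plays the role of a traveling wave of
  degree \<open>n\<close>.
\<close>
definition binomial_mix :: "(nat \<Rightarrow> real \<Rightarrow> complex) \<Rightarrow> nat \<Rightarrow> real \<Rightarrow> complex \<Rightarrow> complex" where
  "binomial_mix g n x y = (\<Sum>k\<le>n. of_nat (n choose k) * g (n - k) x * y ^ k)"

text \<open>
  This is the absorption identity \<open>(n - k) (n choose k) = n (n - 1 choose k)\<close>.  It corresponds to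
  \<open>\<partial>\<^sub>x (x + y)^n = n (x + y)^(n - 1)\<close>; the next lemma is the counterpart for \<open>\<partial>\<^sub>y\<close>.
\<close>
lemma binomial_mix_lower:
  "binomial_mix (\<lambda>k x. of_nat k * g (k - 1) x) n x y = of_nat n * binomial_mix g (n - 1) x y"
proof (cases n)
  case (Suc m)
  have "of_nat (n choose k) * (of_nat (n - k) * g (n - k - 1) x) * y ^ k
      = of_nat n * (of_nat (m choose k) * g (m - k) x * y ^ k)" if "k \<le> m" for k
  proof -
    have "(n choose k) * (n - k) = n * (m choose k)"
      using binomial_absorb_comp[of n k] Suc by (simp add: mult.commute)
    then have "(of_nat (n choose k) * of_nat (n - k) :: complex) = of_nat n * of_nat (m choose k)"
      by (metis of_nat_mult)
    moreover have "n - k - 1 = m - k" using Suc by simp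
    ultimately show ?thesis by (metis (no_types, lifting) mult.assoc)
  qed
  then have "(\<Sum>k\<le>m. of_nat (n choose k) * (of_nat (n - k) * g (n - k - 1) x) * y ^ k)
      = of_nat n * binomial_mix g m x y"
    unfolding binomial_mix_def sum_distrib_left by (intro sum.cong) auto
  then show ?thesis
    by (simp add: Suc binomial_mix_def[of _ "Suc m"] del: of_nat_Suc)
qed (simp add: binomial_mix_def)

lemma binomial_mix_deriv_second:
  "(\<Sum>k\<le>n. of_nat (n choose k) * g (n - k) x * (of_nat k * y ^ (k - 1))) = of_nat n * binomial_mix g (n - 1) x y"
proof (cases n)
  case (Suc m)
  have "of_nat (Suc m choose Suc k) * g (Suc m - Suc k) x * (of_nat (Suc k) * y ^ k)
      = of_nat (Suc m) * (of_nat (m choose k) * g (m - k) x * y ^ k)" for k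
  proof -
    have "(of_nat (Suc k) * of_nat (Suc m choose Suc k) :: complex) = of_nat (Suc m) * of_nat (m choose k)"
      by (metis Suc_times_binomial of_nat_mult)
    then show ?thesis
      by (simp del: of_nat_Suc binomial_Suc_Suc add: mult_ac)
  qed
  then have "(\<Sum>k\<le>m. of_nat (Suc m choose Suc k) * g (Suc m - Suc k) x * (of_nat (Suc k) * y ^ k))
      = of_nat (Suc m) * binomial_mix g m x y"
    unfolding binomial_mix_def sum_distrib_left by (intro sum.cong refl)
  then show ?thesis
    unfolding Suc sum.atMost_Suc_shift by (simp del: of_nat_Suc binomial_Suc_Suc)
qed simp

lemma binomial_mix_derivative:
  fixes c d :: real
  assumes "\<And>k. (g k has_vector_derivative g' k x) (at x)"
  shows "((\<lambda>s. binomial_mix g n (x + s) (of_real (c * (t + d * s)))) has_vector_derivative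
      binomial_mix g' n x (of_real (c * t)) + of_real (c * d) * (of_nat n * binomial_mix g (n - 1) x (of_real (c * t)))) (at 0)"
proof -
  let ?y = "of_real (c * t) :: complex"
  have y: "((\<lambda>s. of_real (c * (t + d * s)) ^ k) has_vector_derivative
      of_real (c * d) * (of_nat k * ?y ^ (k - 1))) (at 0)" for k
  proof -
    have "((\<lambda>s. (c * (t + d * s)) ^ k) has_real_derivative (c * d) * (real k * (c * t) ^ (k - 1))) (at 0)"
      by (auto intro!: derivative_eq_intros)
    then show ?thesis
      using has_vector_derivative_of_real by (fastforce simp: has_real_derivative_iff_has_vector_derivative)
  qed
  have g: "((\<lambda>s. g k (x + s)) has_vector_derivative g' k x) (at 0)" for k
  proof -
    have "((\<lambda>s. x + s) has_vector_derivative 1) (at 0)"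
      by (auto intro!: derivative_eq_intros)
    from vector_diff_chain_at[OF this, of "g k" "g' k x"] assms show ?thesis by (simp add: o_def)
  qed
  have "((\<lambda>s. binomial_mix g n (x + s) (of_real (c * (t + d * s)))) has_vector_derivative
     (\<Sum>k\<le>n. of_nat (n choose k) * g (n - k) (x + 0) * (of_real (c * d) * (of_nat k * ?y ^ (k - 1)))
        + of_nat (n choose k) * g' (n - k) x * of_real (c * (t + d * 0)) ^ k)) (at 0)"
    unfolding binomial_mix_def
    by (intro has_vector_derivative_sum has_vector_derivative_mult has_vector_derivative_mult_right y g)
  also have "(\<Sum>k\<le>n. of_nat (n choose k) * g (n - k) (x + 0) * (of_real (c * d) * (of_nat k * ?y ^ (k - 1)))
        + of_nat (n choose k) * g' (n - k) x * of_real (c * (t + d * 0)) ^ k)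
     = binomial_mix g' n x ?y + of_real (c * d) *
         (\<Sum>k\<le>n. of_nat (n choose k) * g (n - k) x * (of_nat k * ?y ^ (k - 1)))"
    by (simp add: binomial_mix_def sum.distrib sum_distrib_left mult_ac add.commute)
  finally show ?thesis by (simp only: binomial_mix_deriv_second)
qed

lemma binomial_mix_one_term:
  assumes "\<And>k. k \<ge> 2 \<Longrightarrow> g k x = 0"
  shows "binomial_mix g n x y = g 0 x * y ^ n + g 1 x * (of_nat n * y ^ (n - 1))"
proof (cases n)
  case (Suc m)
  have "(\<Sum>k<m. of_nat (Suc m choose k) * g (Suc m - k) x * y ^ k) = 0"
    by (rule sum.neutral) (use assms in auto)
  moreover have "{..Suc m} = insert (Suc m) (insert m {..<m})" by auto
  ultimately show ?thesis by (simp add: binomial_mix_def Suc mult_ac)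
qed (simp add: binomial_mix_def)

text \<open>
  The sums over even \<open>k\<close> and over odd \<open>k\<close> are the even and odd parts in \<open>t\<close> of the full binomial sum.
  For \<open>n = 0\<close> only the even part is a wave polynomial, namely \<open>u\<^sub>0 = f\<close>.
\<close>
lemma wave_poly_eq_binomial_mix:
  assumes "n > 0 \<or> \<sigma> = 1" "\<sigma> = 1 \<or> \<sigma> = -1"
  obtains m where "\<And>x t. wave_poly f m x t
    = 1 / 2 * (binomial_mix (phi f) n x (of_real t) + \<sigma> * binomial_mix (phi f) n x (of_real (- t)))"
proof -
  have half: "1 / 2 * (binomial_mix (phi f) n x (of_real t) + \<sigma> * binomial_mix (phi f) n x (of_real (- t)))
     = (\<Sum>k\<in>{k\<in>{..n}. if \<sigma> = 1 then even k else odd k}. of_nat (n choose k) * phi f (n - k) x * of_real t ^ k)"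
    for x t
  proof -
    have "1 / 2 * (binomial_mix (phi f) n x (of_real t) + \<sigma> * binomial_mix (phi f) n x (of_real (- t)))
        = (\<Sum>k\<le>n. of_nat (n choose k) * phi f (n - k) x * (1 / 2 * (of_real t ^ k + \<sigma> * (- of_real t) ^ k)))"
      by (simp add: binomial_mix_def sum_distrib_left sum_distrib_right sum.distrib[symmetric] algebra_simps)
    also have "\<dots> = (\<Sum>k\<le>n. if (if \<sigma> = 1 then even k else odd k)
        then of_nat (n choose k) * phi f (n - k) x * of_real t ^ k else 0)"
      using assms(2) by (intro sum.cong refl) (auto simp: power_minus_odd)
    finally show ?thesis by (subst sum.inter_filter) simp_all
  qed
  consider "n = 0" "\<sigma> = 1" | "n > 0" "\<sigma> = 1" | "n > 0" "\<sigma> = -1" using assms by auto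
  then show ?thesis
  proof cases
    case 1
    then show ?thesis
      by (intro that[of 0]) (simp add: wave_poly_def binomial_mix_def phi_def)
  next
    case 2
    then have "odd (2 * n - 1)" "(2 * n - 1 + 1) div 2 = n" "2 * n - 1 \<noteq> 0" by auto
    then have "wave_poly f (2 * n - 1) x t
        = 1 / 2 * (binomial_mix (phi f) n x (of_real t) + \<sigma> * binomial_mix (phi f) n x (of_real (- t)))" for x t
      unfolding half using 2 by (simp add: wave_poly_def atMost_atLeast0)
    then show ?thesis by (rule that)
  next
    case 3
    have "{k \<in> {1..n}. odd k} = {k \<in> {..n}. odd k}"
      by (auto simp: Suc_le_eq odd_pos)
    then have "wave_poly f (2 * n) x t
        = 1 / 2 * (binomial_mix (phi f) n x (of_real t) + \<sigma> * binomial_mix (phi f) n x (of_real (- t)))" for x t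
      unfolding half using 3 by (simp add: wave_poly_def)
    then show ?thesis by (rule that)
  qed
qed

lemma continuous_on_binomial_mix:
  assumes "b > 0" "\<And>k. continuous_on {-b..b} (g k)"
  shows "continuous_on (closure (open_square b)) (\<lambda>(x, t). binomial_mix g n x (of_real (c * t)))"
proof -
  have "continuous_on (closure (open_square b)) (\<lambda>p. g k (fst p))" for k
    by (rule continuous_on_compose2[OF assms(2)])
      (auto simp: closure_open_square[OF assms(1)] intro!: continuous_intros)
  then show ?thesis
    unfolding binomial_mix_def case_prod_beta by (intro continuous_intros)
qed

lemma bounded_binomial_mix:
  assumes "b > 0" "\<And>k. continuous_on {-b..b} (g k)"
  shows "bounded ((\<lambda>(x, t). binomial_mix g n x (of_real (c * t))) ` open_square b)"
proof (rule bounded_subset)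
  show "bounded ((\<lambda>(x, t). binomial_mix g n x (of_real (c * t))) ` closure (open_square b))"
    by (intro compact_imp_bounded compact_continuous_image continuous_on_binomial_mix
        compact_closure_open_square assms)
qed (use closure_subset in blast)

section \<open>Polynomial Cauchy data\<close>

text \<open>
  \<open>g\<close>, \<open>h\<close> and \<open>k\<close> are the values on the axis \<open>x = 0\<close> of a combination of wave polynomials and of
  its two Riemann invariants.
\<close>
definition attains_cauchy_data ::
  "(real \<Rightarrow> complex) \<Rightarrow> (real \<Rightarrow> complex) \<Rightarrow> real \<Rightarrow> (real \<Rightarrow> complex) \<Rightarrow> (real \<Rightarrow> complex)
    \<Rightarrow> (real \<Rightarrow> complex) \<Rightarrow> bool" where
  "attains_cauchy_data f q b g h k \<longleftrightarrow> (\<exists>N a v z.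
     riemann_system q b (\<lambda>(x, t). \<Sum>n\<le>N. a n * wave_poly f n x t) v z \<and>
     (\<forall>t. (\<Sum>n\<le>N. a n * wave_poly f n 0 t) = g t \<and> v (0, t) = h t \<and> z (0, t) = k t))"

lemma attains_cauchy_data_zero: "attains_cauchy_data f q b (\<lambda>t. 0) (\<lambda>t. 0) (\<lambda>t. 0)"
  unfolding attains_cauchy_data_def
  by (intro exI[of _ 0] exI[of _ "\<lambda>n. 0"] exI[of _ "\<lambda>p. 0"]) (simp add: riemann_system_zero case_prod_beta')

lemma attains_cauchy_data_add:
  assumes "attains_cauchy_data f q b g h k" "attains_cauchy_data f q b g' h' k'"
  shows "attains_cauchy_data f q b (\<lambda>t. g t + g' t) (\<lambda>t. h t + h' t) (\<lambda>t. k t + k' t)"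
proof -
  obtain N a v z where 1: "riemann_system q b (\<lambda>(x, t). \<Sum>n\<le>N. a n * wave_poly f n x t) v z"
      "\<And>t. (\<Sum>n\<le>N. a n * wave_poly f n 0 t) = g t \<and> v (0, t) = h t \<and> z (0, t) = k t"
    using assms(1) unfolding attains_cauchy_data_def by blast
  obtain N' a' v' z' where 2: "riemann_system q b (\<lambda>(x, t). \<Sum>n\<le>N'. a' n * wave_poly f n x t) v' z'"
      "\<And>t. (\<Sum>n\<le>N'. a' n * wave_poly f n 0 t) = g' t \<and> v' (0, t) = h' t \<and> z' (0, t) = k' t"
    using assms(2) unfolding attains_cauchy_data_def by blast
  define c where "c n = (if n \<le> N then a n else 0) + (if n \<le> N' then a' n else 0)" for n
  have pad: "(\<Sum>n\<le>max N N'. (if n \<le> M then d n else 0) * wave_poly f n x t) = (\<Sum>n\<le>M. d n * wave_poly f n x t)"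
    if "M \<le> max N N'" for M d x t
  proof -
    have "(\<Sum>n\<le>max N N'. (if n \<le> M then d n else 0) * wave_poly f n x t)
        = (\<Sum>n\<in>{..M}. (if n \<le> M then d n else 0) * wave_poly f n x t)"
      using that by (intro sum.mono_neutral_right) auto
    then show ?thesis by simp
  qed
  have c: "(\<Sum>n\<le>max N N'. c n * wave_poly f n x t)
     = (\<Sum>n\<le>N. a n * wave_poly f n x t) + (\<Sum>n\<le>N'. a' n * wave_poly f n x t)" for x t
    unfolding c_def distrib_right sum.distrib by (simp add: pad)
  have "riemann_system q b (\<lambda>(x, t). \<Sum>n\<le>max N N'. c n * wave_poly f n x t) (\<lambda>p. v p + v' p) (\<lambda>p. z p + z' p)"
    using riemann_system_add[OF 1(1) 2(1)] by (simp add: c case_prod_beta')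
  moreover have "(\<Sum>n\<le>max N N'. c n * wave_poly f n 0 t) = g t + g' t \<and> v (0, t) + v' (0, t) = h t + h' t
     \<and> z (0, t) + z' (0, t) = k t + k' t" for t
    using 1(2)[of t] 2(2)[of t] by (simp add: c)
  ultimately show ?thesis
    unfolding attains_cauchy_data_def by blast
qed

lemma attains_cauchy_data_cmult:
  assumes "attains_cauchy_data f q b g h k"
  shows "attains_cauchy_data f q b (\<lambda>t. c * g t) (\<lambda>t. c * h t) (\<lambda>t. c * k t)"
proof -
  obtain N a v z where 1: "riemann_system q b (\<lambda>(x, t). \<Sum>n\<le>N. a n * wave_poly f n x t) v z"
      "\<And>t. (\<Sum>n\<le>N. a n * wave_poly f n 0 t) = g t \<and> v (0, t) = h t \<and> z (0, t) = k t"
    using assms(1) unfolding attains_cauchy_data_def by blast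
  have c: "(\<Sum>n\<le>N. (c * a n) * wave_poly f n x t) = c * (\<Sum>n\<le>N. a n * wave_poly f n x t)" for x t
    by (simp add: sum_distrib_left mult.assoc)
  have "riemann_system q b (\<lambda>(x, t). \<Sum>n\<le>N. (c * a n) * wave_poly f n x t) (\<lambda>p. c * v p) (\<lambda>p. c * z p)"
    using riemann_system_cmult[OF 1(1), of c] by (simp only: c case_prod_beta')
  moreover have "(\<Sum>n\<le>N. (c * a n) * wave_poly f n 0 t) = c * g t \<and> c * v (0, t) = c * h t \<and> c * z (0, t) = c * k t" for t
    using 1(2)[of t] by (simp only: c)
  ultimately show ?thesis
    unfolding attains_cauchy_data_def by (intro exI[of _ N] exI[of _ "\<lambda>n. c * a n"]) blast
qed

lemma attains_cauchy_data_cong: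
  assumes "attains_cauchy_data f q b g h k"
    and "\<And>t. g t = g' t" "\<And>t. h t = h' t" "\<And>t. k t = k' t"
  shows "attains_cauchy_data f q b g' h' k'"
proof -
  have "g = g'" "h = h'" "k = k'" using assms by auto
  then show ?thesis using assms(1) by simp
qed

lemma attains_cauchy_data_sum:
  assumes "finite I" "\<And>i. i \<in> I \<Longrightarrow> attains_cauchy_data f q b (g i) (h i) (k i)"
  shows "attains_cauchy_data f q b (\<lambda>t. \<Sum>i\<in>I. g i t) (\<lambda>t. \<Sum>i\<in>I. h i t) (\<lambda>t. \<Sum>i\<in>I. k i t)"
  using assms
proof (induction I rule: finite_induct)
  case empty
  show ?case using attains_cauchy_data_zero by simp
next
  case (insert i I)
  then show ?case using attains_cauchy_data_add[of f q b "g i" "h i" "k i"] by simp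
qed

context nonvanishing_solution
begin

text \<open>
  Write \<open>V\<^sub>n\<close> for the binomial sum at \<open>y = c t\<close> with \<open>c = \<plusminus>1\<close>.  Then \<open>\<partial>\<^sub>t V\<^sub>n = c n V\<^sub>n\<^sub>-\<^sub>1\<close> and, by the
  equation for \<open>\<phi>\<^sub>k\<close>, \<open>\<partial>\<^sub>x\<^sub>x V\<^sub>n = q V\<^sub>n + n (n - 1) V\<^sub>n\<^sub>-\<^sub>2\<close>, which differs from \<open>\<partial>\<^sub>t\<^sub>t V\<^sub>n\<close> by
  \<open>q V\<^sub>n\<close> since \<open>c\<^sup>2 = 1\<close>.
\<close>
lemma riemann_system_binomial_mix:
  assumes c: "c * c = (1::real)"
  shows "riemann_system q b (\<lambda>(x, t). binomial_mix (phi f) n x (of_real (c * t)))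
    (\<lambda>(x, t). binomial_mix (phi' f f') n x (of_real (c * t))
        + of_real c * (of_nat n * binomial_mix (phi f) (n - 1) x (of_real (c * t))))
    (\<lambda>(x, t). binomial_mix (phi' f f') n x (of_real (c * t))
        - of_real c * (of_nat n * binomial_mix (phi f) (n - 1) x (of_real (c * t))))"
    (is "riemann_system q b (\<lambda>(x, t). ?w x t) (\<lambda>(x, t). ?v x t) (\<lambda>(x, t). ?z x t)")
proof -
  let ?C = "of_real c :: complex"
  let ?y = "\<lambda>t. of_real (c * t) :: complex"
  have cc: "?C * (?C * A) = A" for A
    using c by (metis mult.assoc mult_1 of_real_1 of_real_mult)
  note cont = continuous_on_phi
  have bdd: "bounded ((\<lambda>p. case p of (x, t) \<Rightarrow> binomial_mix (phi' f f') n x (?y t)) ` open_square b)"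
    "bounded ((\<lambda>p. ?C * (of_nat n * (case p of (x, t) \<Rightarrow> binomial_mix (phi f) (n - 1) x (?y t)))) ` open_square b)"
  proof -
    show "bounded ((\<lambda>p. case p of (x, t) \<Rightarrow> binomial_mix (phi' f f') n x (?y t)) ` open_square b)"
      by (intro bounded_binomial_mix b cont)
    have "bounded ((\<lambda>p. case p of (x, t) \<Rightarrow> binomial_mix (phi f) (n - 1) x (?y t)) ` open_square b)"
      by (intro bounded_binomial_mix b cont)
    from bounded_linear_image[OF this bounded_linear_mult_right[of "?C * of_nat n"]]
    show "bounded ((\<lambda>p. ?C * (of_nat n * (case p of (x, t) \<Rightarrow> binomial_mix (phi f) (n - 1) x (?y t)))) ` open_square b)"
      by (simp add: image_image mult.assoc)
  qed
  have "bounded ((\<lambda>(x, t). ?v x t) ` open_square b)" "bounded ((\<lambda>(x, t). ?z x t) ` open_square b)"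
    using bounded_plus_comp[OF bdd] bounded_minus_comp[OF bdd] by (simp_all add: case_prod_beta')
  moreover have "((\<lambda>s. ?w (x + s) t) has_vector_derivative (?v x t + ?z x t) / 2) (at 0)"
    "((\<lambda>s. ?v (x + s) (t - s)) has_vector_derivative q x * ?w x t) (at 0)"
    "((\<lambda>s. ?z (x + s) (t + s)) has_vector_derivative q x * ?w x t) (at 0)"
    if "(x, t) \<in> open_square b" for x t
  proof -
    have x: "x \<in> {-b<..<b}" using that b by (auto simp: open_square_eq)
    have d1: "(phi f k has_vector_derivative phi' f f' k x) (at x)"
      and d2: "(phi' f f' k has_vector_derivative
          q x * phi f k x + of_nat k * (of_nat (k - 1) * phi f (k - 2) x)) (at x)" for k
      by (rule phi_derivative[OF x] phi'_derivative[OF x]; assumption)+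
    let ?h = "\<lambda>k x. q x * phi f k x + of_nat k * (of_nat (k - 1) * phi f (k - 2) x)"
    have second: "binomial_mix ?h n x y
        = q x * binomial_mix (phi f) n x y
          + of_nat n * (of_nat (n - 1) * binomial_mix (phi f) (n - 2) x y)" for y
    proof -
      have "binomial_mix ?h n x y
        = q x * binomial_mix (phi f) n x y
          + binomial_mix (\<lambda>k x. of_nat k * (of_nat (k - 1) * phi f (k - 1 - 1) x)) n x y"
        by (simp add: binomial_mix_def sum_distrib_left sum.distrib distrib_left distrib_right mult_ac numeral_2_eq_2)
      also have "binomial_mix (\<lambda>k x. of_nat k * (of_nat (k - 1) * phi f (k - 1 - 1) x)) n x y
          = of_nat n * (of_nat (n - 1) * binomial_mix (phi f) (n - 1 - 1) x y)"
        using binomial_mix_lower[where g = "\<lambda>k x. of_nat k * phi f (k - 1) x"]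
          binomial_mix_lower[where g = "phi f"] by simp
      finally show ?thesis by (simp add: numeral_2_eq_2)
    qed
    have along: "((\<lambda>s. binomial_mix (phi' f f') n (x + s) (?y (t + d * s))) has_vector_derivative
          q x * ?w x t + of_nat n * (of_nat (n - 1) * binomial_mix (phi f) (n - 2) x (?y t))
          + of_real (c * d) * (of_nat n * binomial_mix (phi' f f') (n - 1) x (?y t))) (at 0)" (is ?D1)
       "((\<lambda>s. ?C * (of_nat n * binomial_mix (phi f) (n - 1) (x + s) (?y (t + d * s)))) has_vector_derivative
          ?C * (of_nat n * (binomial_mix (phi' f f') (n - 1) x (?y t)
          + of_real (c * d) * (of_nat (n - 1) * binomial_mix (phi f) (n - 2) x (?y t))))) (at 0)" (is ?D2) for d
    proof -
      show ?D1
        using binomial_mix_derivative[where g = "phi' f f'" and g' = ?h and x = x, OF d2,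
            where n = n and c = c and d = d and t = t]
        unfolding second .
      have "((\<lambda>s. binomial_mix (phi f) (n - 1) (x + s) (?y (t + d * s))) has_vector_derivative
          binomial_mix (phi' f f') (n - 1) x (?y t)
          + of_real (c * d) * (of_nat (n - 1) * binomial_mix (phi f) (n - 2) x (?y t))) (at 0)"
        using binomial_mix_derivative[where g = "phi f" and g' = "phi' f f'" and x = x, OF d1,
            where n = "n - 1" and c = c and d = d and t = t]
        unfolding diff_diff_left one_add_one .
      then show ?D2 by (intro has_vector_derivative_mult_right)
    qed
    show "((\<lambda>s. ?w (x + s) t) has_vector_derivative (?v x t + ?z x t) / 2) (at 0)"
      using binomial_mix_derivative[where g = "phi f" and g' = "phi' f f'" and x = x, OF d1, where n = n and c = c and d = 0 and t = t] by simp
    show "((\<lambda>s. ?v (x + s) (t - s)) has_vector_derivative q x * ?w x t) (at 0)"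
      using has_vector_derivative_add[OF along[of "-1"]] by (simp add: algebra_simps cc)
    show "((\<lambda>s. ?z (x + s) (t + s)) has_vector_derivative q x * ?w x t) (at 0)"
      using has_vector_derivative_diff[OF along[of 1]] by (simp add: algebra_simps cc)
  qed
  moreover have "continuous_on (closure (open_square b)) (\<lambda>(x, t). ?w x t)"
    by (intro continuous_on_binomial_mix b cont)
  ultimately show ?thesis
    unfolding riemann_system_def prod.case by blast
qed

lemma binomial_mix_phi_at_0:
  "binomial_mix (phi f) n 0 y = y ^ n"
  "binomial_mix (phi' f f') n 0 y = f' 0 * y ^ n + of_nat n * y ^ (n - 1)"
  using phi_at_0 phi'_at_0
  by (simp_all add: binomial_mix_one_term)

text \<open>
  A wave polynomial is half the sum or difference of a binomial sum and its reflection in \<open>t\<close>.  By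
  linearity so are its data, with signs \<open>\<sigma> = 1\<close> and \<open>\<sigma> = -1\<close>.
\<close>
lemma attains_symmetrised_data:
  assumes "n > 0 \<or> \<sigma> = 1" "\<sigma> = 1 \<or> \<sigma> = -1"
  shows "attains_cauchy_data f q b
    (\<lambda>t. (of_real t ^ n + \<sigma> * (- of_real t) ^ n) / 2)
    (\<lambda>t. f' 0 * ((of_real t ^ n + \<sigma> * (- of_real t) ^ n) / 2) + of_nat n * of_real t ^ (n - 1))
    (\<lambda>t. f' 0 * ((of_real t ^ n + \<sigma> * (- of_real t) ^ n) / 2) + \<sigma> * (of_nat n * (- of_real t) ^ (n - 1)))"
proof -
  obtain m where m: "\<And>x t. wave_poly f m x t
    = 1 / 2 * (binomial_mix (phi f) n x (of_real t) + \<sigma> * binomial_mix (phi f) n x (of_real (- t)))"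
    using wave_poly_eq_binomial_mix[OF assms] by blast
  define a :: "nat \<Rightarrow> complex" where "a k = (if k = m then 1 else 0)" for k
  have "(\<Sum>k\<le>m. a k * wave_poly f k x t) = (\<Sum>k\<in>{m}. a k * wave_poly f k x t)" for x t
    by (rule sum.mono_neutral_right) (auto simp: a_def)
  then have a: "(\<Sum>k\<le>m. a k * wave_poly f k x t) = wave_poly f m x t" for x t
    by (simp add: a_def)
  note R = riemann_system_binomial_mix[of 1 n] riemann_system_binomial_mix[of "-1" n]
  have "riemann_system q b (\<lambda>(x, t). \<Sum>k\<le>m. a k * wave_poly f k x t)
     (\<lambda>p. 1 / 2 * ((case p of (x, t) \<Rightarrow> binomial_mix (phi' f f') n x (of_real (1 * t))
        + of_real 1 * (of_nat n * binomial_mix (phi f) (n - 1) x (of_real (1 * t))))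
      + \<sigma> * (case p of (x, t) \<Rightarrow> binomial_mix (phi' f f') n x (of_real (- 1 * t))
        + of_real (- 1) * (of_nat n * binomial_mix (phi f) (n - 1) x (of_real (- 1 * t))))))
     (\<lambda>p. 1 / 2 * ((case p of (x, t) \<Rightarrow> binomial_mix (phi' f f') n x (of_real (1 * t))
        - of_real 1 * (of_nat n * binomial_mix (phi f) (n - 1) x (of_real (1 * t))))
      + \<sigma> * (case p of (x, t) \<Rightarrow> binomial_mix (phi' f f') n x (of_real (- 1 * t))
        - of_real (- 1) * (of_nat n * binomial_mix (phi f) (n - 1) x (of_real (- 1 * t))))))"
    using riemann_system_cmult[OF riemann_system_add[OF R(1) riemann_system_cmult[OF R(2), of \<sigma>]], of "1/2"]
    by (simp add: a m case_prod_beta')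
  then show ?thesis
    unfolding attains_cauchy_data_def
    by (intro exI conjI, assumption) (simp add: a m binomial_mix_phi_at_0 algebra_simps add_divide_distrib diff_divide_distrib)
qed

text \<open>
  The choice \<open>\<sigma> = (-1)^n\<close> makes the values \<open>t^n\<close> add up and the terms \<open>n t^(n-1)\<close> in \<open>w\<^sub>x\<close> cancel.
  The opposite sign, used in the next lemma, does the reverse.
\<close>
lemma attains_power_position:
  "attains_cauchy_data f q b (\<lambda>t. of_real t ^ n)
    (\<lambda>t. f' 0 * of_real t ^ n + of_nat n * of_real t ^ (n - 1))
    (\<lambda>t. f' 0 * of_real t ^ n - of_nat n * of_real t ^ (n - 1))"
proof (cases "even n")
  case True
  then show ?thesis
    by (intro attains_cauchy_data_cong[OF attains_symmetrised_data[of n 1]])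
      (cases n; simp add: power_minus_odd)+
next
  case False
  then have "n > 0" by (simp add: odd_pos)
  with False show ?thesis
    by (intro attains_cauchy_data_cong[OF attains_symmetrised_data[of n "-1"]])
      (simp_all add: power_minus_odd)
qed

lemma attains_power_velocity:
  "attains_cauchy_data f q b (\<lambda>t. 0) (\<lambda>t. of_real t ^ n) (\<lambda>t. of_real t ^ n)"
proof -
  have "attains_cauchy_data f q b (\<lambda>t. 0) (\<lambda>t. of_nat (Suc n) * of_real t ^ n) (\<lambda>t. of_nat (Suc n) * of_real t ^ n)"
  proof (cases "even n")
    case True
    then show ?thesis
      by (intro attains_cauchy_data_cong[OF attains_symmetrised_data[of "Suc n" 1]])
        (simp_all add: power_minus_odd del: of_nat_Suc)
  next
    case False
    then show ?thesis
      by (intro attains_cauchy_data_cong[OF attains_symmetrised_data[of "Suc n" "-1"]])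
        (simp_all add: power_minus_odd del: of_nat_Suc)
  qed
  from attains_cauchy_data_cmult[OF this, of "1 / of_nat (Suc n)"] show ?thesis
    by (simp del: of_nat_Suc)
qed

lemma attains_polynomial_data:
  "attains_cauchy_data f q b (\<lambda>t. \<Sum>k\<le>d. p k * of_real t ^ k)
    (\<lambda>t. f' 0 * (\<Sum>k\<le>d. p k * of_real t ^ k) + (\<Sum>k\<le>d. p k * (of_nat k * of_real t ^ (k - 1)))
         + (\<Sum>k\<le>e. r k * of_real t ^ k))
    (\<lambda>t. f' 0 * (\<Sum>k\<le>d. p k * of_real t ^ k) - (\<Sum>k\<le>d. p k * (of_nat k * of_real t ^ (k - 1)))
         + (\<Sum>k\<le>e. r k * of_real t ^ k))"
proof -
  have P: "attains_cauchy_data f q b (\<lambda>t. \<Sum>k\<le>d. p k * of_real t ^ k)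
    (\<lambda>t. \<Sum>k\<le>d. p k * (f' 0 * of_real t ^ k + of_nat k * of_real t ^ (k - 1)))
    (\<lambda>t. \<Sum>k\<le>d. p k * (f' 0 * of_real t ^ k - of_nat k * of_real t ^ (k - 1)))"
    by (intro attains_cauchy_data_sum attains_cauchy_data_cmult attains_power_position finite_atMost)
  have V: "attains_cauchy_data f q b (\<lambda>t. \<Sum>k\<le>e. r k * 0)
    (\<lambda>t. \<Sum>k\<le>e. r k * of_real t ^ k) (\<lambda>t. \<Sum>k\<le>e. r k * of_real t ^ k)"
    by (intro attains_cauchy_data_sum attains_cauchy_data_cmult attains_power_velocity finite_atMost)
  show ?thesis
    by (rule attains_cauchy_data_cong[OF attains_cauchy_data_add[OF P V]])
      (simp_all add: sum_distrib_left sum.distrib sum_subtractf distrib_left right_diff_distrib mult_ac)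
qed

end

section \<open>Approximation\<close>

lemma complex_polynomial_approximation:
  fixes g :: "real \<Rightarrow> complex"
  assumes "continuous_on {a..b} g" "e > 0"
  obtains c :: "nat \<Rightarrow> complex" and d
    where "\<And>t. t \<in> {a..b} \<Longrightarrow> norm (g t - (\<Sum>k\<le>d. c k * of_real t ^ k)) < e"
proof -
  obtain p where p: "polynomial_function p" "\<And>t. t \<in> {a..b} \<Longrightarrow> norm (g t - p t) < e"
    using Stone_Weierstrass_polynomial_function[OF compact_Icc assms] by blast
  have "real_polynomial_function (Re \<circ> p)" "real_polynomial_function (Im \<circ> p)"
    using p(1) bounded_linear_Re bounded_linear_Im by (auto simp: polynomial_function_def)
  then obtain r m s n where rs: "Re \<circ> p = (\<lambda>t. \<Sum>k\<le>m. r k * t ^ k)" "Im \<circ> p = (\<lambda>t. \<Sum>k\<le>n. s k * t ^ k)"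
    by (auto simp: real_polynomial_function_iff_sum)
  define c where "c k = Complex (if k \<le> m then r k else 0) (if k \<le> n then s k else 0)" for k
  have pad: "(\<Sum>k\<le>max m n. (if k \<le> l then w k else 0) * t ^ k) = (\<Sum>k\<le>l. w k * t ^ k)"
    if "l \<le> max m n" for l and w :: "nat \<Rightarrow> real" and t
  proof -
    have "(\<Sum>k\<le>max m n. (if k \<le> l then w k else 0) * t ^ k) = (\<Sum>k\<le>l. (if k \<le> l then w k else 0) * t ^ k)"
      using that by (intro sum.mono_neutral_right) auto
    then show ?thesis by simp
  qed
  have "p t = (\<Sum>k\<le>max m n. c k * of_real t ^ k)" for t
  proof (rule complex_eqI)
    show "Re (p t) = Re (\<Sum>k\<le>max m n. c k * of_real t ^ k)"
      using fun_cong[OF rs(1), of t] pad[of m r t] by (simp add: c_def of_real_power[symmetric] del: of_real_power)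
    show "Im (p t) = Im (\<Sum>k\<le>max m n. c k * of_real t ^ k)"
      using fun_cong[OF rs(2), of t] pad[of n s t] by (simp add: c_def of_real_power[symmetric] del: of_real_power)
  qed
  then show ?thesis using that p(2) by metis
qed

lemma polynomial_has_vector_derivative:
  fixes p :: "nat \<Rightarrow> complex"
  shows "((\<lambda>t. \<Sum>k\<le>d. p k * of_real t ^ k) has_vector_derivative
    (\<Sum>k\<le>d. p k * (of_nat k * of_real t ^ (k - 1)))) (at t)"
proof -
  have "((\<lambda>t. of_real t ^ k :: complex) has_vector_derivative of_nat k * of_real t ^ (k - 1)) (at t)" for k
  proof -
    have "((\<lambda>t. t ^ k) has_real_derivative real k * t ^ (k - 1)) (at t)"
      by (auto intro!: derivative_eq_intros)
    then show ?thesis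
      using has_vector_derivative_of_real by (fastforce simp: has_real_derivative_iff_has_vector_derivative)
  qed
  then show ?thesis
    by (intro has_vector_derivative_sum has_vector_derivative_mult_right)
qed


context nonvanishing_solution
begin

text \<open>
  Choose polynomials \<open>G'\<close> near \<open>u\<^sub>t(0,\<cdot>)\<close> and \<open>R\<close> near \<open>u\<^sub>x(0,\<cdot>) - f'(0) u(0,\<cdot>)\<close>, and let \<open>G\<close> be the
  antiderivative of \<open>G'\<close> with \<open>G(0) = u(0,0)\<close>.  The combination of wave polynomials with data
  \<open>(G, f'(0) G + R)\<close> then has nearly the data of \<open>u\<close>, and stability applies to the difference.
\<close>
lemma wave_poly_approximation:
  fixes u :: "real \<times> real \<Rightarrow> complex"
  assumes q: "continuous_on {-b..b} q"
    and C2: "C2_on_closure u (open_square b)"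
    and pde: "\<And>x t. (x, t) \<in> open_square b \<Longrightarrow>
           partial_x (partial_x u) (x, t) - q x * u (x, t) = partial_t (partial_t u) (x, t)"
    and eps: "\<epsilon> > 0"
  shows "\<exists>N a. \<forall>(x, t)\<in>closure (open_square b). norm ((\<Sum>n\<le>N. a n * wave_poly f n x t) - u (x, t)) < \<epsilon>"
proof -
  let ?S = "open_square b"
  obtain Q where Q: "\<And>x. \<bar>x\<bar> \<le> b \<Longrightarrow> norm (q x) \<le> Q"
  proof -
    have "bounded (q ` {-b..b})"
      using q by (intro compact_imp_bounded compact_continuous_image) auto
    then obtain Q where "\<And>y. y \<in> q ` {-b..b} \<Longrightarrow> norm y \<le> Q" unfolding bounded_iff by blast
    then show ?thesis using that[of Q] by (simp add: abs_le_iff minus_le_iff)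
  qed
  define L where "L = 2 * exp ((2 * Q + 2) * b)"
  \<comment> \<open>The error in the data is at most \<open>K e\<close>, and stability amplifies it by at most \<open>L\<close>.\<close>
  define K where "K = 3 + (norm (f' 0) + 1) * b"
  have K: "K > 0" and L: "L > 0"
    using b by (auto simp: K_def L_def intro!: add_pos_nonneg)
  define e where "e = \<epsilon> / (2 * L * K)"
  have e: "e > 0" using eps K L by (simp add: e_def)
  have on_axis: "(0, t) \<in> ?S" if "\<bar>t\<bar> < b" for t
    using that b by (simp add: open_square_eq)
  have axis: "continuous_on {-b..b} (\<lambda>t. g (0, t))"
    if "continuous_on (closure ?S) g" for g :: "real \<times> real \<Rightarrow> complex"
    by (rule continuous_on_compose2[OF that])
      (auto simp: closure_open_square[OF b] intro!: continuous_intros)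
  have "extends_continuously (partial_x u) ?S" "extends_continuously (partial_t u) ?S"
      and P: "has_partials_on u ?S" and cu: "continuous_on (closure ?S) u"
    using C2 by (auto simp: C2_on_closure_def)
  then obtain gx gt where gx: "continuous_on (closure ?S) gx" "\<And>p. p \<in> ?S \<Longrightarrow> gx p = partial_x u p"
    and gt: "continuous_on (closure ?S) gt" "\<And>p. p \<in> ?S \<Longrightarrow> gt p = partial_t u p"
    unfolding extends_continuously_def by metis
  obtain c :: "nat \<Rightarrow> complex" and d
    where c: "\<And>t. t \<in> {-b..b} \<Longrightarrow> norm (gt (0, t) - (\<Sum>k\<le>d. c k * of_real t ^ k)) < e"
    using complex_polynomial_approximation[OF axis[OF gt(1)] e] by blast
  have "continuous_on {-b..b} (\<lambda>t. gx (0, t) - f' 0 * u (0, t))"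
    by (intro continuous_intros axis gx cu)
  then obtain r :: "nat \<Rightarrow> complex" and m
    where r: "\<And>t. t \<in> {-b..b} \<Longrightarrow> norm (gx (0, t) - f' 0 * u (0, t) - (\<Sum>k\<le>m. r k * of_real t ^ k)) < e"
    using complex_polynomial_approximation[OF _ e] by blast
  define p where "p k = (case k of 0 \<Rightarrow> u (0, 0) | Suc j \<Rightarrow> c j / of_nat (Suc j))" for k
  define G where "G t = (\<Sum>k\<le>Suc d. p k * of_real t ^ k)" for t :: real
  define G' where "G' t = (\<Sum>k\<le>d. c k * of_real t ^ k)" for t :: real
  define R where "R t = (\<Sum>k\<le>m. r k * of_real t ^ k)" for t :: real
  have G'_eq: "(\<Sum>k\<le>Suc d. p k * (of_nat k * of_real t ^ (k - 1))) = G' t" for t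
    unfolding G'_def sum.atMost_Suc_shift by (simp add: p_def del: of_nat_Suc)
  have dG: "(G has_vector_derivative G' t) (at t)" for t
    using polynomial_has_vector_derivative[of p "Suc d" t] unfolding G'_eq G_def .
  have G0: "G 0 = u (0, 0)"
    unfolding G_def sum.atMost_Suc_shift by (simp add: p_def)
  have uG: "norm (u (0, t) - G t) \<le> e * b" if t: "\<bar>t\<bar> < b" for t
  proof -
    have d: "((\<lambda>t. u (0, t) - G t) has_vector_derivative partial_t u (0, s) - G' s) (at s)"
      and n: "norm (partial_t u (0, s) - G' s) \<le> e" if "\<bar>s\<bar> < b" for s
      using has_vector_derivative_diff[OF has_vector_derivative_partial_t[OF P on_axis[OF that]] dG]
        c[of s] gt(2)[OF on_axis[OF that]] that by (auto simp: G'_def abs_less_iff intro: less_imp_le)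
    have "norm (u (0, t) - G t) \<le> e * \<bar>t\<bar>"
    proof (cases "t \<ge> 0")
      case True
      then have "norm ((u (0, t) - G t) - (u (0, 0) - G 0)) \<le> e * (t - 0)"
        using t by (intro norm_increment_le[where g' = "\<lambda>s. partial_t u (0, s) - G' s"] d n) auto
      then show ?thesis using True G0 by simp
    next
      case False
      then have "norm ((u (0, 0) - G 0) - (u (0, t) - G t)) \<le> e * (0 - t)"
        using t by (intro norm_increment_le[where g' = "\<lambda>s. partial_t u (0, s) - G' s"] d n) auto
      then show ?thesis using False G0 by (simp add: norm_minus_commute)
    qed
    also have "\<dots> \<le> e * b" using t e by simp
    finally show ?thesis .
  qed
  have "attains_cauchy_data f q b G (\<lambda>t. f' 0 * G t + G' t + R t) (\<lambda>t. f' 0 * G t - G' t + R t)"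
    using attains_polynomial_data[of p "Suc d" r m]
    unfolding G'_eq G_def[symmetric] R_def[symmetric] .
  then obtain N a v z where sys: "riemann_system q b (\<lambda>(x, t). \<Sum>n\<le>N. a n * wave_poly f n x t) v z"
    and data: "\<And>t. (\<Sum>n\<le>N. a n * wave_poly f n 0 t) = G t" "\<And>t. v (0, t) = f' 0 * G t + G' t + R t"
      "\<And>t. z (0, t) = f' 0 * G t - G' t + R t"
    unfolding attains_cauchy_data_def by blast
  define w where "w = (\<lambda>(x, t). \<Sum>n\<le>N. a n * wave_poly f n x t)"
  note diff_sys = riemann_system_add[OF sys[folded w_def]
      riemann_system_cmult[OF riemann_system_classical_solution[OF b C2 pde], of "-1"]]
  have "norm (w pt + - 1 * u pt) \<le> 2 * (K * e) * exp ((2 * Q + 2) * b)" if "pt \<in> closure ?S" for pt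
  proof (rule riemann_system_stability[OF b diff_sys Q _ _ that])
    fix t :: real assume t: "\<bar>t\<bar> < b"
    have S: "(0, t) \<in> ?S" and tb: "t \<in> {-b..b}" using on_axis t by auto
    define A where "A = G t - u (0, t)"
    define B where "B = G' t - partial_t u (0, t)"
    define C where "C = R t - (partial_x u (0, t) - f' 0 * u (0, t))"
    have A: "norm A \<le> e * b" and B: "norm B \<le> e" and C: "norm C \<le> e"
      using uG[OF t] c[OF tb] r[OF tb] gx(2)[OF S] gt(2)[OF S]
      by (auto simp: A_def B_def C_def G'_def R_def norm_minus_commute intro: less_imp_le)
    have fA: "norm (f' 0 * A) \<le> norm (f' 0) * (e * b)"
      using A by (simp add: norm_mult mult_left_mono)
    have Ke: "K * e = 3 * e + norm (f' 0) * (e * b) + e * b"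
      by (simp add: K_def algebra_simps)
    have pos: "0 \<le> e * b" "0 \<le> norm (f' 0) * (e * b)" using e b by auto
    have eqs: "w (0, t) + - 1 * u (0, t) = A"
      "v (0, t) + - 1 * (partial_x u (0, t) + partial_t u (0, t)) = f' 0 * A + B + C"
      "z (0, t) + - 1 * (partial_x u (0, t) - partial_t u (0, t)) = f' 0 * A - B + C"
      using data[of t] by (simp_all add: w_def A_def B_def C_def algebra_simps)
    have "norm (f' 0 * A + B + C) \<le> norm (f' 0 * A) + norm B + norm C"
      by (intro order_trans[OF norm_triangle_ineq] add_mono norm_triangle_ineq order_refl)
    moreover have "norm (f' 0 * A - B + C) \<le> norm (f' 0 * A) + norm B + norm C"
      by (intro order_trans[OF norm_triangle_ineq] add_mono norm_triangle_ineq4 order_refl)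
    ultimately show "norm (w (0, t) + - 1 * u (0, t)) \<le> K * e \<and>
        norm (v (0, t) + - 1 * (partial_x u (0, t) + partial_t u (0, t))) \<le> K * e \<and>
        norm (z (0, t) + - 1 * (partial_x u (0, t) - partial_t u (0, t))) \<le> K * e"
      unfolding eqs Ke using A B C fA pos e by linarith
  qed (use K e in auto)
  moreover have "2 * (K * e) * exp ((2 * Q + 2) * b) < \<epsilon>"
  proof -
    have "2 * (K * e) * exp ((2 * Q + 2) * b) = L * K * e" by (simp add: L_def)
    also have "\<dots> = \<epsilon> / 2" using K L by (simp add: e_def)
    finally show ?thesis using eps by simp
  qed
  ultimately show ?thesis
    by (intro exI[of _ N] exI[of _ a]) (force simp: w_def)
qed

end

text \<open>
  Padding coefficients with zeros turns an approximation using \<open>N\<close> terms into one using \<open>N'\<close> terms for every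
  \<open>N' \<ge> N\<close>.  So for each \<open>N\<close> one may take coefficients realising the best accuracy \<open>1 / (k + 1)\<close>,
  \<open>k \<le> N\<close>, that \<open>N\<close> terms can reach; the bound \<open>k \<le> N\<close> ensures that a best \<open>k\<close> exists.
\<close>
lemma uniform_limit_from_approximations:
  fixes g :: "nat \<Rightarrow> 'a \<Rightarrow> complex"
  assumes "\<And>e. e > 0 \<Longrightarrow> \<exists>N a. \<forall>p\<in>S. norm ((\<Sum>n\<le>N. a n * g n p) - u p) < e"
  shows "\<exists>a :: nat \<Rightarrow> nat \<Rightarrow> complex. uniform_limit S (\<lambda>N p. \<Sum>n\<le>N. a N n * g n p) u sequentially"
proof -
  define ok where "ok N k a \<longleftrightarrow> (\<forall>p\<in>S. norm ((\<Sum>n\<le>N. a n * g n p) - u p) < 1 / real (Suc k))" for N k a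
  \<comment> \<open>The element \<open>0\<close> is a default for the finitely many \<open>N\<close> at which no accuracy is reached yet.\<close>
  define best where "best N = Max ({0} \<union> {k. k \<le> N \<and> (\<exists>a. ok N k a)})" for N
  have fin: "finite ({0} \<union> {k. k \<le> N \<and> (\<exists>a. ok N k a)})" for N by simp
  define a where "a N = (SOME a. ok N (best N) a)" for N
  have ok_mono: "\<exists>a. ok N' k a" if "ok N k a" "N \<le> N'" for N N' k a
  proof -
    have "(\<Sum>n\<le>N'. (if n \<le> N then a n else 0) * g n p) = (\<Sum>n\<le>N. (if n \<le> N then a n else 0) * g n p)" for p
      using that(2) by (intro sum.mono_neutral_right) auto
    then have "ok N' k (\<lambda>n. if n \<le> N then a n else 0)"
      using that(1) unfolding ok_def by simp
    then show ?thesis by blast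
  qed
  have "uniform_limit S (\<lambda>N p. \<Sum>n\<le>N. a N n * g n p) u sequentially"
  proof (rule uniform_limitI)
    fix e :: real assume "e > 0"
    then obtain k where k: "1 / real (Suc k) < e" using nat_approx_posE by blast
    obtain M a0 where "ok M k a0" using assms[of "1 / real (Suc k)"] by (auto simp: ok_def)
    have "\<forall>p\<in>S. dist (\<Sum>n\<le>N. a N n * g n p) (u p) < e" if N: "N \<ge> max M k" for N
    proof -
      have kmem: "k \<in> {0} \<union> {k. k \<le> N \<and> (\<exists>a. ok N k a)}"
        using ok_mono[OF \<open>ok M k a0\<close>, of N] N by auto
      then have "k \<le> best N" unfolding best_def by (rule Max_ge[OF fin])
      have "best N \<in> {0} \<union> {k. k \<le> N \<and> (\<exists>a. ok N k a)}"
        unfolding best_def by (rule Max_in[OF fin]) simp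
      then have "\<exists>a. ok N (best N) a"
        using \<open>k \<le> best N\<close> ok_mono[OF \<open>ok M k a0\<close>, of N] N by auto
      then have "ok N (best N) (a N)" unfolding a_def by (rule someI_ex)
      moreover have "1 / real (Suc (best N)) \<le> 1 / real (Suc k)"
        using \<open>k \<le> best N\<close> by (intro divide_left_mono) auto
      ultimately show ?thesis
        using k unfolding ok_def dist_norm by fastforce
    qed
    then show "\<forall>\<^sub>F N in sequentially. \<forall>p\<in>S. dist (\<Sum>n\<le>N. a N n * g n p) (u p) < e"
      unfolding eventually_sequentially by blast
  qed
  then show ?thesis by blast
qed

theorem theorem22:
  fixes b :: real
    and q f f' f'' :: "real \<Rightarrow> complex"
    and u :: "real \<times> real \<Rightarrow> complex"
  assumes "b > 0"
    and "continuous_on {-b..b} q"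
    and "\<And>x. x \<in> {-b..b} \<Longrightarrow> (f has_vector_derivative f' x) (at x within {-b..b})"
    and "\<And>x. x \<in> {-b..b} \<Longrightarrow> (f' has_vector_derivative f'' x) (at x within {-b..b})"
    and "continuous_on {-b..b} f''"
    and "\<And>x. x \<in> {-b..b} \<Longrightarrow> f'' x - q x * f x = 0"
    and "\<And>x. x \<in> {-b..b} \<Longrightarrow> f x \<noteq> 0"
    and "f 0 = 1"
    and "C2_on_closure u (open_square b)"
    and "\<And>x t. (x, t) \<in> open_square b \<Longrightarrow>
           partial_x (partial_x u) (x, t) - q x * u (x, t) = partial_t (partial_t u) (x, t)"
  shows "\<exists>a :: nat \<Rightarrow> nat \<Rightarrow> complex.
           uniform_limit (closure (open_square b))
             (\<lambda>N (x, t). \<Sum>n=0..N. a N n * wave_poly f n x t) u sequentially"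
proof -
  interpret nonvanishing_solution b f f' f'' q
    using assms by unfold_locales auto
  have "\<exists>N a. \<forall>p\<in>closure (open_square b).
      norm ((\<Sum>n\<le>N. a n * (case p of (x, t) \<Rightarrow> wave_poly f n x t)) - u p) < e" if "e > 0" for e
    using wave_poly_approximation[OF assms(2,9,10) that] by (simp add: case_prod_beta')
  from uniform_limit_from_approximations[OF this] show ?thesis
    by (simp add: case_prod_beta' atMost_atLeast0)
qed

end
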